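(* Let $n\ge 2$ be an integer, $k,c_b>0$, $\rho_0>0$, and let $\lambda_{1,0},\dots,\lambda_{n,0}$ be real numbers with $\lambda_{1,0}=\cdots=\lambda_{J,0}<\lambda_{J+1,0}\le\cdots\le\lambda_{n,0}$ for some integer $1\le J\le n$. Consider the system $$\lambda_i'=-\lambda_i^2+\frac{k}{n}(\rho-c_b)\ (i=1,\dots,n),\qquad \rho'=-\rho\lambda,\quad \lambda=\sum_{i=1}^n\lambda_i,\qquad \rho(0)=\rho_0,\ \lambda_i(0)=\lambda_{i,0},$$ suppose its maximal interval of existence is $[0,t_B)$ with $0<t_B<\infty$, let $u_i(t)=e^{\int_0^t\lambda_i(s)\,ds}$, and let $p,q$ satisfy $\lim_{t\to t_B^-}u_1'(t)u_n(t)=-p$, $\lim_{t\to t_B^-}u_1(t)u_n'(t)=q$. If $p=q$, then $J=2$, $n=4$, and $(\lambda_{1,0}-\lambda_{3,0})(\lambda_{1,0}-\lambda_{4,0})=k\rho_0$. Moreover, there exists $C>0$ such that $\lim_{t\to t_B^-}(t_B-t)^2\lambda_1(t)=-C$, $\lim_{t\to t_B^-}(t_B-t)^2\lambda_i(t)=C$ for $i=3,4$, and $\lim_{t\to t_B^-}(t_B-t)^4\rho(t)=\frac4kC^2$.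
   Context: Solutions are real-valued and continuously differentiable on $[0,t_B)$. It is known that the limits defining $p,q$ exist. *)

theory Defs
  imports "HOL-Analysis.Analysis"
begin

definition is_sol ::
  "nat \<Rightarrow> real \<Rightarrow> real \<Rightarrow> real \<Rightarrow> (nat \<Rightarrow> real)
   \<Rightarrow> (nat \<Rightarrow> real \<Rightarrow> real) \<Rightarrow> (real \<Rightarrow> real) \<Rightarrow> real \<Rightarrow> bool" where
  "is_sol n k cb rho0 lam0 lam rho T \<longleftrightarrow>
     rho 0 = rho0 \<and> (\<forall>i\<in>{1..n}. lam i 0 = lam0 i) \<and>
     (\<forall>t\<in>{0..<T}.
        (rho has_real_derivative (- rho t * (\<Sum>i=1..n. lam i t))) (at t within {0..<T}) \<and>
        (\<forall>i\<in>{1..n}. (lam i has_real_derivative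
             (- ((lam i t) ^ 2) + k / real n * (rho t - cb))) (at t within {0..<T})))"

definition uu :: "(nat \<Rightarrow> real \<Rightarrow> real) \<Rightarrow> nat \<Rightarrow> real \<Rightarrow> real" where
  "uu lam i t = exp (integral {0..t} (lam i))"

end

theory Submission
  imports Defs
begin

text \<open>
  The functions \<open>u\<^sub>i\<close> solve the common linear equation \<open>u'' = (k/n) (\<rho> - c\<^sub>b) u\<close>, so their Wronskians
  are constant, every \<open>u\<^sub>i\<close> is a combination of \<open>v = u\<^sub>1\<close> and \<open>w = u\<^sub>n\<close>, and
  \<open>\<rho> \<Prod>u\<^sub>i = \<rho>\<^sub>0\<close>. A solution with \<open>u\<^sub>1\<close> bounded away from \<open>0\<close> is bounded and hence extends, so
  maximality forces \<open>inf u\<^sub>1 = 0\<close>; for equal initial data this contradicts conservation of energy.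
  Otherwise \<open>p = q\<close> gives \<open>p = d/2\<close> with \<open>d = \<lambda>\<^sub>n\<^sub>,\<^sub>0 - \<lambda>\<^sub>1\<^sub>,\<^sub>0\<close>, and \<open>P = v w\<close> satisfies
  \<open>P \<rightarrow> 0\<close>, \<open>P' \<rightarrow> 0\<close> and \<open>P P'' = (2k/n) (\<rho> - c\<^sub>b) P\<^sup>2 + P'\<^sup>2/2 - 2p\<^sup>2\<close>. A positive lower bound on the
  right-hand side is incompatible with \<open>P \<rightarrow> 0\<close>, and so is a negative upper bound; therefore
  \<open>\<rho> P\<^sup>2 \<rightarrow> n p\<^sup>2 / k\<close>. Since \<open>\<rho> P\<^sup>2\<close> is asymptotic to a constant times \<open>v\<^bsup>2-J\<^esup> w\<^bsup>2-n+J\<^esup>\<close> and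
  \<open>ln w / (- ln v) \<rightarrow> 1\<close>, this yields \<open>n = 2J\<close>, then \<open>J = 2\<close>, then the condition on the initial data.
  Finally \<open>\<surd>P\<close> is concave with bounded second derivative, so \<open>P\<close> vanishes exactly like \<open>(t\<^sub>B - t)\<^sup>2\<close>.
\<close>

section \<open>Local existence and continuation\<close>

text \<open>As \<open>nat\<close> is discrete, every slice \<open>{i} \<times> UNIV\<close> is open,
  so continuity can be checked slice by slice. This lets a whole system of functions of time be
  coded as one function on \<open>nat \<times> real\<close>.\<close>

lemma continuous_on_nat_prod:
  fixes f :: "nat \<times> real \<Rightarrow> real"
  assumes "\<And>i. continuous_on UNIV (\<lambda>t. f (i, t))"
  shows "continuous_on UNIV f"
proof -
  have "isCont f z" for z
  proof -
    obtain i t where z: "z = (i, t)" by fastforce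
    have "open ({i} \<times> (UNIV :: real set))"
      by (intro open_Times) (auto simp: open_discrete)
    moreover have "continuous_on ({i} \<times> (UNIV :: real set)) (\<lambda>p. f (i, snd p))"
      by (rule continuous_on_compose2[OF assms[of i]]) (auto intro: continuous_intros)
    then have "continuous_on ({i} \<times> (UNIV :: real set)) f"
      by (rule continuous_on_eq) auto
    ultimately show ?thesis
      by (metis SigmaI UNIV_I continuous_on_eq_continuous_at singletonI z)
  qed
  then show ?thesis by (simp add: continuous_at_imp_continuous_on)
qed

text \<open>The library proves completeness only over a metric domain, but \<^typ>\<open>nat\<close> has no metric.\<close>

lemma complete_UNIV_bcontfun:
  "complete (UNIV :: ('a::topological_space \<Rightarrow>\<^sub>C 'b::complete_space) set)"
  unfolding complete_def
proof (intro allI impI)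
  fix f :: "nat \<Rightarrow> ('a \<Rightarrow>\<^sub>C 'b)"
  assume "(\<forall>n. f n \<in> UNIV) \<and> Cauchy f"
  then have "uniformly_Cauchy_on UNIV (\<lambda>n. apply_bcontfun (f n))"
    unfolding uniformly_Cauchy_on_def Cauchy_def by (meson dist_fun_lt_imp_dist_val_lt)
  then obtain g where "uniform_limit UNIV (\<lambda>n. apply_bcontfun (f n)) g sequentially"
    using Cauchy_uniformly_convergent uniformly_convergent_on_def by blast
  then show "\<exists>l\<in>UNIV. f \<longlonglongrightarrow> l"
    using uniform_limit_bcontfunE[OF _ sequentially_bot] by blast
qed

text \<open>Banach's fixed point theorem for the integral operator \<open>\<Phi>\<close> on bounded
  continuous functions. \<open>lip\<close> is a Lipschitz condition in the maximum norm over
  coordinates \<open>0..n\<close>, so \<open>L * h < 1\<close> makes \<open>\<Phi>\<close> a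
  contraction in the supremum metric.\<close>

lemma picard_system:
  fixes F :: "(nat \<Rightarrow> real) \<Rightarrow> nat \<Rightarrow> real" and x0 :: "nat \<Rightarrow> real"
  assumes h: "0 < h" and L: "0 \<le> L" "L * h < 1"
    and lip: "\<And>x y i B. i \<le> n \<Longrightarrow> (\<And>j. j \<le> n \<Longrightarrow> \<bar>x j - y j\<bar> \<le> B) \<Longrightarrow>
                 \<bar>F x i - F y i\<bar> \<le> L * B"
  obtains x :: "nat \<Rightarrow> real \<Rightarrow> real"
  where "\<And>i. i \<le> n \<Longrightarrow> x i a = x0 i"
    and "\<And>i t. i \<le> n \<Longrightarrow> t \<in> {a..a+h} \<Longrightarrow>
           (x i has_real_derivative F (\<lambda>j. x j t) i) (at t within {a..a+h})"
proof -
  define g where "g X i s = F (\<lambda>j. apply_bcontfun X (j, s)) i"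
    for X :: "(nat \<times> real) \<Rightarrow>\<^sub>C real" and i and s :: real
  \<comment> \<open>Clamping time to \<open>[a, a+h]\<close> makes each iterate bounded and
    continuous on the whole line; coordinates beyond \<open>n\<close> are set to \<open>0\<close> in
    \<open>\<Phi>\<close> so that its range stays bounded.\<close>
  define cl where "cl t = max a (min (a + h) t)" for t
  define \<Phi> where "\<Phi> X = (\<lambda>(i, t). if i \<le> n then x0 i + integral {a..cl t} (g X i) else 0)"
    for X :: "(nat \<times> real) \<Rightarrow>\<^sub>C real"
  have cl: "cl t \<in> {a..a+h}" for t using h by (auto simp: cl_def)
  have contX: "continuous_on UNIV (\<lambda>s. apply_bcontfun X (j, s))"
    for X :: "(nat \<times> real) \<Rightarrow>\<^sub>C real" and j
    by (rule continuous_on_compose2[OF continuous_on_apply_bcontfun[of UNIV]])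
       (auto intro!: continuous_intros)
  have contg: "continuous_on S (g X i)" if i: "i \<le> n" for X i S
  proof -
    have "continuous_on UNIV (g X i)"
      unfolding continuous_on_iff
    proof (intro ballI allI impI)
      fix s :: real and e :: real assume e: "e > 0"
      \<comment> \<open>The Lipschitz bound requires \<open>L * B < e\<close>; the
        \<open>+ 1\<close> covers the case \<open>L = 0\<close>.\<close>
      define B where "B = e / (2 * (L + 1))"
      have B: "B > 0" "L * B < e"
        using e L(1) by (auto simp: B_def field_simps intro!: add_nonneg_pos)
      have "\<forall>\<^sub>F s' in nhds s. \<forall>j\<in>{..n}. dist (apply_bcontfun X (j, s')) (apply_bcontfun X (j, s)) < B"
      proof (intro eventually_ball_finite ballI)
        fix j assume "j \<in> {..n}"
        have "((\<lambda>s. apply_bcontfun X (j, s)) \<longlongrightarrow> apply_bcontfun X (j, s)) (nhds s)"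
          using contX[of X j] unfolding continuous_on_eq_continuous_at[OF open_UNIV]
            isCont_def tendsto_at_iff_tendsto_nhds[of "\<lambda>s. apply_bcontfun X (j, s)"] by blast
        then show "\<forall>\<^sub>F s' in nhds s. dist (apply_bcontfun X (j, s')) (apply_bcontfun X (j, s)) < B"
          using B(1) by (rule tendstoD)
      qed auto
      then obtain d where d: "d > 0"
        "\<And>s'. dist s' s < d \<Longrightarrow> \<forall>j\<in>{..n}. dist (apply_bcontfun X (j, s')) (apply_bcontfun X (j, s)) < B"
        unfolding eventually_nhds_metric by blast
      have "dist (g X i s') (g X i s) < e" if "dist s' s < d" for s'
      proof -
        have "\<bar>g X i s' - g X i s\<bar> \<le> L * B"
          unfolding g_def
          by (rule lip[OF i]) (use d(2)[OF that] in \<open>auto simp: dist_real_def less_imp_le\<close>)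
        then show ?thesis using B by (simp add: dist_real_def)
      qed
      then show "\<exists>d>0. \<forall>s'\<in>UNIV. dist s' s < d \<longrightarrow> dist (g X i s') (g X i s) < e"
        using d(1) by blast
    qed
    then show ?thesis by (rule continuous_on_subset) auto
  qed
  have deriv: "((\<lambda>t. integral {a..t} (g X i)) has_real_derivative g X i t) (at t within {a..a+h})"
    if "i \<le> n" "t \<in> {a..a+h}" for X i t
    using integral_has_real_derivative[OF contg[OF that(1)] that(2)] .
  have \<Phi>: "\<Phi> X \<in> bcontfun" for X
  proof -
    have "continuous_on UNIV (\<lambda>t. \<Phi> X (i, t))" for i
    proof (cases "i \<le> n")
      case True
      have "continuous_on {a..a+h} (\<lambda>t. integral {a..t} (g X i))"
        by (rule DERIV_continuous_on[OF deriv[OF True]])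
      then have "continuous_on UNIV (\<lambda>t. integral {a..cl t} (g X i))"
        by (rule continuous_on_compose2) (use cl in \<open>auto simp: cl_def intro!: continuous_intros\<close>)
      then show ?thesis using True by (auto simp: \<Phi>_def intro!: continuous_intros)
    qed (simp add: \<Phi>_def)
    then have "continuous_on UNIV (\<Phi> X)" by (rule continuous_on_nat_prod)
    moreover have "bounded (range (\<Phi> X))"
    proof -
      have "bounded ((\<lambda>t. x0 i + integral {a..t} (g X i)) ` {a..a+h})" if "i \<le> n" for i
        by (intro compact_imp_bounded compact_continuous_image continuous_intros
              DERIV_continuous_on[OF deriv[OF that]]) auto
      then have "bounded (insert 0 (\<Union>i\<in>{..n}. (\<lambda>t. x0 i + integral {a..t} (g X i)) ` {a..a+h}))"
        by (auto simp: bounded_UN)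
      then show ?thesis
      proof (rule bounded_subset, intro image_subsetI)
        fix z :: "nat \<times> real"
        show "\<Phi> X z \<in> insert 0 (\<Union>i\<in>{..n}. (\<lambda>t. x0 i + integral {a..t} (g X i)) ` {a..a+h})"
        proof (cases "fst z \<le> n")
          case True
          have "\<Phi> X z = (\<lambda>t. x0 (fst z) + integral {a..t} (g X (fst z))) (cl (snd z))"
            using True by (simp add: \<Phi>_def split_beta)
          then show ?thesis using cl[of "snd z"] True by blast
        qed (simp add: \<Phi>_def split_beta)
      qed
    qed
    ultimately show ?thesis by (simp add: bcontfun_def)
  qed
  have contr: "dist (Bcontfun (\<Phi> X)) (Bcontfun (\<Phi> Y)) \<le> (L * h) * dist X Y" for X Y
  proof (rule dist_bound)
    fix z :: "nat \<times> real"
    obtain i t where z: "z = (i, t)" by fastforce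
    have "dist (\<Phi> X z) (\<Phi> Y z) \<le> (L * h) * dist X Y"
    proof (cases "i \<le> n")
      case True
      have "\<bar>g X i s - g Y i s\<bar> \<le> L * dist X Y" for s
        unfolding g_def
        by (rule lip[OF True]) (metis dist_bounded dist_real_def)
      then have "norm (integral {a..cl t} (\<lambda>s. g X i s - g Y i s)) \<le> (L * dist X Y) * (cl t - a)"
        using cl[of t] by (intro integral_bound continuous_intros contg True) auto
      also have "\<dots> \<le> (L * dist X Y) * h"
        using cl[of t] L(1) by (intro mult_left_mono) auto
      also have "integral {a..cl t} (\<lambda>s. g X i s - g Y i s)
          = integral {a..cl t} (g X i) - integral {a..cl t} (g Y i)"
        by (intro integral_diff integrable_continuous_real contg True)
      finally show ?thesis using True by (simp add: z \<Phi>_def dist_real_def mult_ac)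
    qed (use L h in \<open>simp add: z \<Phi>_def\<close>)
    then show "dist (apply_bcontfun (Bcontfun (\<Phi> X)) z) (apply_bcontfun (Bcontfun (\<Phi> Y)) z)
        \<le> (L * h) * dist X Y"
      by (simp add: Bcontfun_inverse \<Phi>)
  qed
  have "\<exists>!X. Bcontfun (\<Phi> X) = X"
    using Banach_fix[OF complete_UNIV_bcontfun, of "L * h" "\<lambda>X. Bcontfun (\<Phi> X)"] contr L h
    by simp
  then obtain X where X: "Bcontfun (\<Phi> X) = X" by blast
  define x where "x i t = apply_bcontfun X (i, t)" for i t
  have x: "x i t = x0 i + integral {a..t} (g X i)" if "i \<le> n" "t \<in> {a..a+h}" for i t
  proof -
    have "x i t = \<Phi> X (i, t)"
      unfolding x_def using X \<Phi>[of X] by (metis Bcontfun_inverse)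
    moreover have "cl t = t" using that by (auto simp: cl_def)
    ultimately show ?thesis using that by (simp add: \<Phi>_def)
  qed
  show thesis
  proof (rule that)
    show "x i a = x0 i" if "i \<le> n" for i using x[of i a] that h by simp
    fix i t assume it: "i \<le> n" "t \<in> {a..a+h}"
    have "((\<lambda>t. x0 i + integral {a..t} (g X i)) has_real_derivative g X i t) (at t within {a..a+h})"
      by (rule DERIV_cong[OF DERIV_add[OF DERIV_const deriv[OF it]]]) simp
    then have "(x i has_real_derivative g X i t) (at t within {a..a+h})"
      by (rule has_field_derivative_transform_within[where d = 1]) (use it x in auto)
    then show "(x i has_real_derivative F (\<lambda>j. x j t) i) (at t within {a..a+h})"
      by (simp add: g_def x_def)
  qed
qed

text \<open>At the junction \<open>t = a\<close> both derivative hypotheses apply with the same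
  \<open>D\<close>, so the one-sided derivatives match; \<open>fg\<close> makes the glued function
  agree with \<open>g\<close> there.\<close>

lemma has_real_derivative_glue:
  fixes f g :: "real \<Rightarrow> real"
  assumes "0 \<le> a" "a < T" "0 < h" "t \<in> {0..<a+h}"
    and f: "t \<le> a \<Longrightarrow> (f has_real_derivative D) (at t within {0..<T})"
    and g: "a \<le> t \<Longrightarrow> (g has_real_derivative D) (at t within {a..a+h})"
    and fg: "f a = g a"
  shows "((\<lambda>s. if s \<le> a then f s else g s) has_real_derivative D) (at t within {0..<a+h})"
proof -
  have cl: "closure {0..a} = {0..a}" "closure {a<..<a+h} = {a..a+h}"
    using assms by auto
  have int: "{0..a} \<inter> {a..a+h} = {a}" using assms by auto
  have "((\<lambda>s. if s \<in> {0..a} then f s else g s) has_vector_derivative (if t \<in> {0..a} then D else D))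
      (at t within {0..<a+h})"
    by (rule has_vector_derivative_If_within_closures[where T = "{a<..<a+h}"])
       (use assms in \<open>auto simp: cl int has_real_derivative_iff_has_vector_derivative[symmetric]
          intro!: has_field_derivative_subset[OF f] has_field_derivative_subset[OF g]\<close>)
  then have "((\<lambda>s. if s \<in> {0..a} then f s else g s) has_real_derivative D) (at t within {0..<a+h})"
    by (simp add: has_real_derivative_iff_has_vector_derivative)
  then show ?thesis
    by (rule has_field_derivative_transform_within[where d = 1]) (use assms in auto)
qed

text \<open>The vector field is only locally Lipschitz, so it is truncated at
  \<open>N = M + 1\<close>. The truncated system can be solved for a time \<open>h\<close>
  independent of the starting point, and the solution moves by at most \<open>1\<close> in that
  time, so the truncation stays inactive. Starting close enough to \<open>T\<close> carries the
  solution past \<open>T\<close>.\<close>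

lemma bounded_solution_extends:
  assumes n: "n \<ge> 1" and k: "k \<ge> 0" and cb: "cb \<ge> 0" and T: "T > 0"
    and sol: "is_sol n k cb rho0 lam0 lam rho T"
    and bdl: "\<And>i t. i \<in> {1..n} \<Longrightarrow> t \<in> {0..<T} \<Longrightarrow> \<bar>lam i t\<bar> \<le> M"
    and bdr: "\<And>t. t \<in> {0..<T} \<Longrightarrow> \<bar>rho t\<bar> \<le> M"
  shows "\<exists>T'>T. \<exists>lam' rho'. is_sol n k cb rho0 lam0 lam' rho' T'"
proof -
  define N where "N = M + 1"
  have "M \<ge> 0" using bdr[of 0] T by simp
  then have N: "N \<ge> 1" by (simp add: N_def)
  define c where "c y = max (- N) (min N y)" for y :: real
  have c_bd: "\<bar>c y\<bar> \<le> N" for y using N by (auto simp: c_def)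
  have c_lip: "\<bar>c x - c y\<bar> \<le> \<bar>x - y\<bar>" for x y using N by (auto simp: c_def)
  have c_id: "c y = y" if "\<bar>y\<bar> \<le> N" for y using that by (auto simp: c_def)
  \<comment> \<open>Coordinate \<open>0\<close> carries \<open>rho\<close>, coordinates
    \<open>1..n\<close> carry the \<open>lam i\<close>. Since \<open>c\<close> is 1-Lipschitz with
    values in \<open>[-N, N]\<close>, \<open>F\<close> is globally Lipschitz with constant
    \<open>L\<close> and bounded by \<open>K\<close>.\<close>
  define F where "F x i = (if i = 0 then - c (x 0) * (\<Sum>j=1..n. c (x j))
      else - ((c (x i))^2) + k / real n * (c (x 0) - cb))" for x :: "nat \<Rightarrow> real" and i :: nat
  define L where "L = 2 * real n * N + k / real n"
  define K where "K = real n * N^2 + k / real n * (N + cb)"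
  have kn: "0 \<le> k / real n" using k by simp
  have L0: "L > 0" using N n kn by (simp add: L_def add_pos_nonneg)
  have K0: "K > 0" unfolding K_def using N n kn cb by (intro add_pos_nonneg mult_pos_pos mult_nonneg_nonneg) auto
  have lip: "\<bar>F x i - F y i\<bar> \<le> L * B"
    if i: "i \<le> n" and B: "\<And>j. j \<le> n \<Longrightarrow> \<bar>x j - y j\<bar> \<le> B" for x y i B
  proof -
    have cB: "\<bar>c (x j) - c (y j)\<bar> \<le> B" if "j \<le> n" for j
      using c_lip[of "x j" "y j"] B[OF that] by linarith
    have B0: "B \<ge> 0" using cB[of 0] by linarith
    show ?thesis
    proof (cases "i = 0")
      case True
      let ?Sx = "\<Sum>j=1..n. c (x j)" and ?Sy = "\<Sum>j=1..n. c (y j)"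
      have S: "\<bar>?Sx\<bar> \<le> real n * N"
        using order_trans[OF sum_abs[of "\<lambda>j. c (x j)" "{1..n}"]
            sum_bounded_above[of "{1..n}" "\<lambda>j. \<bar>c (x j)\<bar>" N]] c_bd by simp
      have "\<bar>?Sx - ?Sy\<bar> \<le> (\<Sum>j=1..n. \<bar>c (x j) - c (y j)\<bar>)"
        by (simp add: sum_subtractf[symmetric] sum_abs)
      also have "\<dots> \<le> real n * B"
        using sum_bounded_above[of "{1..n}" "\<lambda>j. \<bar>c (x j) - c (y j)\<bar>" B] cB by simp
      finally have S2: "\<bar>?Sx - ?Sy\<bar> \<le> real n * B" .
      have "F x i - F y i = - ((c (x 0) - c (y 0)) * ?Sx + c (y 0) * (?Sx - ?Sy))"
        using True by (simp add: F_def algebra_simps)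
      then have "\<bar>F x i - F y i\<bar> \<le> \<bar>c (x 0) - c (y 0)\<bar> * \<bar>?Sx\<bar> + \<bar>c (y 0)\<bar> * \<bar>?Sx - ?Sy\<bar>"
        using abs_triangle_ineq[of "(c (x 0) - c (y 0)) * ?Sx" "c (y 0) * (?Sx - ?Sy)"]
        by (simp only: abs_minus_cancel abs_mult)
      also have "\<dots> \<le> B * (real n * N) + N * (real n * B)"
        using cB[of 0] S S2 c_bd[of "y 0"] B0 N by (intro add_mono mult_mono) auto
      also have "\<dots> \<le> L * B" using B0 k by (simp add: L_def algebra_simps)
      finally show ?thesis .
    next
      case False
      have "F x i - F y i = - ((c (x i) - c (y i)) * (c (x i) + c (y i))) + k / real n * (c (x 0) - c (y 0))"
        using False by (simp add: F_def algebra_simps power2_eq_square)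
      then have "\<bar>F x i - F y i\<bar> \<le> \<bar>c (x i) - c (y i)\<bar> * \<bar>c (x i) + c (y i)\<bar> + k / real n * \<bar>c (x 0) - c (y 0)\<bar>"
        using abs_triangle_ineq[of "- ((c (x i) - c (y i)) * (c (x i) + c (y i)))" "k / real n * (c (x 0) - c (y 0))"] k
        by (simp add: abs_mult)
      also have "\<dots> \<le> B * (2 * N) + k / real n * B"
        using cB[of 0] cB[OF i] c_bd[of "x i"] c_bd[of "y i"] B0 N kn
        by (intro add_mono mult_mono mult_left_mono) auto
      also have "\<dots> \<le> L * B"
        using mult_right_mono[of 1 "real n" "B * N * 2"] n B0 N by (simp add: L_def algebra_simps)
      finally show ?thesis .
    qed
  qed
  have Fbd: "\<bar>F x i\<bar> \<le> K" for x i
  proof (cases "i = 0")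
    case True
    have S: "\<bar>\<Sum>j=1..n. c (x j)\<bar> \<le> real n * N"
        using order_trans[OF sum_abs[of "\<lambda>j. c (x j)" "{1..n}"]
            sum_bounded_above[of "{1..n}" "\<lambda>j. \<bar>c (x j)\<bar>" N]] c_bd by simp
    have "\<bar>F x i\<bar> \<le> N * (real n * N)"
      using True S c_bd[of "x 0"] N by (simp add: F_def abs_mult mult_mono)
    also have "\<dots> \<le> K" using k cb N by (simp add: K_def power2_eq_square mult_ac)
    finally show ?thesis .
  next
    case False
    have "\<bar>F x i\<bar> \<le> (c (x i))^2 + k / real n * \<bar>c (x 0) - cb\<bar>"
      using False abs_triangle_ineq[of "- ((c (x i))^2)" "k / real n * (c (x 0) - cb)"] k
      by (simp add: F_def abs_mult)
    also have "\<dots> \<le> N^2 + k / real n * (N + cb)"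
      using c_bd[of "x i"] c_bd[of "x 0"] kn cb N
      by (intro add_mono mult_left_mono) (auto simp: abs_le_square_iff[symmetric])
    also have "\<dots> \<le> K" using mult_right_mono[of 1 "real n" "N^2"] n by (simp add: K_def)
    finally show ?thesis .
  qed
  \<comment> \<open>The bound \<open>1 / K\<close> limits the displacement to \<open>1\<close>; the
    bound \<open>1 / (2 * L)\<close> gives the contraction.\<close>
  define h where "h = min (1 / K) (1 / (2 * L))"
  have h: "h > 0" "K * h \<le> 1" "L * h < 1"
  proof -
    show "h > 0" using K0 L0 by (simp add: h_def)
    have "h \<le> 1 / K" "h \<le> 1 / (2 * L)" by (auto simp: h_def)
    then show "K * h \<le> 1" "L * h < 1" using K0 L0 by (auto simp: field_simps)
  qed
  \<comment> \<open>Starting at most \<open>h / 2\<close> before \<open>T\<close> ensures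
    \<open>a + h > T\<close>; the maximum keeps the start in the domain.\<close>
  define a where "a = max 0 (T - h / 2)"
  have a: "0 \<le> a" "a < T" "a + h > T" using T h by (auto simp: a_def)
  define x0 where "x0 i = (if i = 0 then rho a else lam i a)" for i
  obtain x where x: "\<And>i. i \<le> n \<Longrightarrow> x i a = x0 i"
    "\<And>i t. i \<le> n \<Longrightarrow> t \<in> {a..a+h} \<Longrightarrow>
           (x i has_real_derivative F (\<lambda>j. x j t) i) (at t within {a..a+h})"
    using picard_system[of h L n F a x0] h L0 lip by (auto simp: less_imp_le)
  have xbd: "\<bar>x i t\<bar> \<le> N" if it: "i \<le> n" "t \<in> {a..a+h}" for i t
  proof -
    have "norm (x i t - x i a) \<le> K * norm (t - a)"
      by (rule field_differentiable_bound[where S = "{a..a+h}"])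
         (use x(2) it Fbd h in auto)
    also have "\<dots> \<le> K * h" using it K0 by (intro mult_left_mono) auto
    finally have "\<bar>x i t - x0 i\<bar> \<le> 1" using h x(1) it by simp
    moreover have "\<bar>x0 i\<bar> \<le> M" using bdl bdr a it by (auto simp: x0_def)
    ultimately show ?thesis by (simp add: N_def)
  qed
  define lam' where "lam' i t = (if t \<le> a then lam i t else x i t)" for i t
  define rho' where "rho' t = (if t \<le> a then rho t else x 0 t)" for t
  have "is_sol n k cb rho0 lam0 lam' rho' (a + h)"
    unfolding is_sol_def
  proof (intro conjI ballI)
    show "rho' 0 = rho0" using sol a by (simp add: rho'_def is_sol_def)
    show "lam' i 0 = lam0 i" if "i \<in> {1..n}" for i
      using sol a that by (simp add: lam'_def is_sol_def)
    fix t assume t: "t \<in> {0..<a+h}"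
    have eq: "lam' i t = x i t" if "a \<le> t" "i \<in> {1..n}" for i
      using x(1)[of i] that by (auto simp: lam'_def x0_def)
    have eqr: "rho' t = x 0 t" if "a \<le> t"
      using x(1)[of 0] that by (auto simp: rho'_def x0_def)
    show "(rho' has_real_derivative - rho' t * (\<Sum>i=1..n. lam' i t)) (at t within {0..<a+h})"
      unfolding rho'_def[abs_def]
    proof (rule has_real_derivative_glue[OF a(1,2) h(1) t], fold rho'_def)
      assume "t \<le> a"
      then show "(rho has_real_derivative - rho' t * (\<Sum>i=1..n. lam' i t)) (at t within {0..<T})"
        using sol t a by (auto simp: is_sol_def lam'_def rho'_def)
    next
      assume ta: "a \<le> t"
      have "F (\<lambda>j. x j t) 0 = - rho' t * (\<Sum>i=1..n. lam' i t)"
        using ta t xbd eq eqr by (simp add: F_def c_id)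
      then show "(x 0 has_real_derivative - rho' t * (\<Sum>i=1..n. lam' i t)) (at t within {a..a+h})"
        using x(2)[of 0 t] ta t by auto
    next
      show "rho a = x 0 a" using x(1)[of 0] by (simp add: x0_def)
    qed
    fix i assume i: "i \<in> {1..n}"
    show "(lam' i has_real_derivative - ((lam' i t)^2) + k / real n * (rho' t - cb)) (at t within {0..<a+h})"
      unfolding lam'_def[abs_def]
    proof (rule has_real_derivative_glue[OF a(1,2) h(1) t], fold lam'_def)
      assume "t \<le> a"
      then show "(lam i has_real_derivative - ((lam' i t)^2) + k / real n * (rho' t - cb)) (at t within {0..<T})"
        using sol t a i by (auto simp: is_sol_def lam'_def rho'_def)
    next
      assume ta: "a \<le> t"
      have "F (\<lambda>j. x j t) i = - ((lam' i t)^2) + k / real n * (rho' t - cb)"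
        using ta t xbd eq eqr i by (simp add: F_def c_id)
      then show "(x i has_real_derivative - ((lam' i t)^2) + k / real n * (rho' t - cb)) (at t within {a..a+h})"
        using x(2)[of i t] ta t i by auto
    next
      show "lam i a = x i a" using x(1)[of i] i by (simp add: x0_def)
    qed
  qed
  then show ?thesis using a(3) by blast
qed

section \<open>The associated linear equation\<close>

lemma zero_deriv_imp_eq_initial:
  fixes f :: "real \<Rightarrow> real"
  assumes "\<And>s. s \<in> {0..<T} \<Longrightarrow> (f has_real_derivative 0) (at s within {0..<T})" "t \<in> {0..<T}"
  shows "f t = f 0"
  using has_field_derivative_zero_constant[of "{0..<T}" f] assms by fastforce

lemma nonneg_deriv_imp_ge_initial:
  fixes f :: "real \<Rightarrow> real"
  assumes f: "\<And>s. s \<in> {0..<T} \<Longrightarrow> (f has_real_derivative f' s) (at s within {0..<T})"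
    and nn: "\<And>s. s \<in> {0..<T} \<Longrightarrow> f' s \<ge> 0" and t: "t \<in> {0..<T}"
  shows "f 0 \<le> f t"
proof (rule DERIV_nonneg_imp_increasing_open[where f = f and a = 0 and b = t])
  show "0 \<le> t" using t by simp
  show "\<exists>y. (f has_real_derivative y) (at x) \<and> 0 \<le> y" if "0 < x" "x < t" for x
  proof -
    have "at x within {0..<T} = at x" by (rule at_within_interior) (use that t in auto)
    then show ?thesis using f[of x] nn[of x] that t by auto
  qed
  show "continuous_on {0..t} f"
    by (rule continuous_on_subset[OF DERIV_continuous_on[OF f]]) (use t in auto)
qed

section \<open>Linearisation, Wronskians and continuation of a solution\<close>

locale flow_solution =
  fixes n :: nat and k cb rho0 :: real and lam0 :: "nat \<Rightarrow> real"
    and lam :: "nat \<Rightarrow> real \<Rightarrow> real" and rho :: "real \<Rightarrow> real" and T :: real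
  assumes n2: "n \<ge> 2" and kpos: "k > 0" and cbpos: "cb > 0" and rho0pos: "rho0 > 0"
    and Tpos: "T > 0" and sol: "is_sol n k cb rho0 lam0 lam rho T"
    and lam0_min: "\<And>i. i \<in> {1..n} \<Longrightarrow> lam0 1 \<le> lam0 i"
begin

lemma lam_deriv:
  assumes "i \<in> {1..n}" "t \<in> {0..<T}"
  shows "(lam i has_real_derivative - ((lam i t)^2) + k / real n * (rho t - cb)) (at t within {0..<T})"
  using sol assms by (auto simp: is_sol_def)

lemma rho_deriv:
  assumes "t \<in> {0..<T}"
  shows "(rho has_real_derivative - rho t * (\<Sum>i=1..n. lam i t)) (at t within {0..<T})"
  using sol assms by (auto simp: is_sol_def)

lemma lam_initial: "i \<in> {1..n} \<Longrightarrow> lam i 0 = lam0 i" and rho_initial: "rho 0 = rho0"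
  using sol by (auto simp: is_sol_def)

lemma u_pos: "uu lam i t > 0" and u_initial: "uu lam i 0 = 1"
  by (simp_all add: uu_def)

lemma lam_continuous: "i \<in> {1..n} \<Longrightarrow> continuous_on {0..<T} (lam i)"
  by (rule DERIV_continuous_on[OF lam_deriv])

lemma u_deriv:
  assumes i: "i \<in> {1..n}" and t: "t \<in> {0..<T}"
  shows "(uu lam i has_real_derivative lam i t * uu lam i t) (at t within {0..<T})"
proof -
  \<comment> \<open>The fundamental theorem of calculus is applied on the compact interval
    \<open>[0, b]\<close>, which coincides with \<open>[0, T)\<close> near \<open>t\<close>.\<close>
  define b where "b = (t + T) / 2"
  have b: "t < b" "b < T" using t by (auto simp: b_def)
  have "((\<lambda>x. integral {0..x} (lam i)) has_real_derivative lam i t) (at t within {0..b})"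
    by (rule integral_has_real_derivative[OF continuous_on_subset[OF lam_continuous[OF i]]])
       (use b t in auto)
  moreover have "at t within {0..b} = at t within {0..<T}"
    by (rule at_within_nhd[of _ "{..<b}"]) (use b in auto)
  ultimately have "((\<lambda>x. integral {0..x} (lam i)) has_real_derivative lam i t) (at t within {0..<T})"
    by simp
  from DERIV_chain2[OF DERIV_exp this] show ?thesis
    unfolding uu_def[abs_def] by (simp add: mult.commute)
qed

text \<open>With \<open>u' = lam u\<close> the Riccati equation becomes linear: the term
  \<open>lam^2 u\<close> from the product rule cancels the quadratic term of
  \<open>lam'\<close>.\<close>

lemma du_deriv:
  assumes i: "i \<in> {1..n}" and t: "t \<in> {0..<T}"
  shows "((\<lambda>t. lam i t * uu lam i t) has_real_derivative k / real n * (rho t - cb) * uu lam i t)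
           (at t within {0..<T})"
  by (rule DERIV_cong[OF DERIV_mult[OF lam_deriv[OF i t] u_deriv[OF i t]]])
     (simp add: algebra_simps power2_eq_square)

lemma one_in: "1 \<in> {1..n}" using n2 by simp

text \<open>Because \<open>lam i * uu lam i\<close> is the derivative of \<open>uu lam i\<close>,
  the left side is the Wronskian of two solutions of one equation without first-order term; it keeps
  its value at \<open>0\<close>.\<close>

lemma wronskian:
  assumes i: "i \<in> {1..n}" and t: "t \<in> {0..<T}"
  shows "(lam i t - lam 1 t) * uu lam i t * uu lam 1 t = lam0 i - lam0 1"
proof -
  let ?W = "\<lambda>t. (lam i t * uu lam i t) * uu lam 1 t - (lam 1 t * uu lam 1 t) * uu lam i t"
  have "(?W has_real_derivative 0) (at s within {0..<T})" if s: "s \<in> {0..<T}" for s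
    by (rule DERIV_cong[OF DERIV_diff[OF
          DERIV_mult[OF du_deriv[OF i s] u_deriv[OF one_in s]]
          DERIV_mult[OF du_deriv[OF one_in s] u_deriv[OF i s]]]])
       (simp add: algebra_simps)
  from zero_deriv_imp_eq_initial[OF this t] show ?thesis
    using lam_initial[OF i] lam_initial[OF one_in] by (simp add: u_initial algebra_simps)
qed

lemma ratio_deriv:
  assumes i: "i \<in> {1..n}" and t: "t \<in> {0..<T}"
  shows "((\<lambda>t. uu lam i t / uu lam 1 t) has_real_derivative (lam0 i - lam0 1) / (uu lam 1 t)^2)
           (at t within {0..<T})"
proof -
  have "uu lam 1 t \<noteq> 0" using u_pos[of 1 t] by simp
  from DERIV_divide[OF u_deriv[OF i t] u_deriv[OF one_in t] this] show ?thesis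
    by (rule DERIV_cong) (unfold wronskian[OF i t, symmetric], simp add: algebra_simps power2_eq_square)
qed

lemma u_ge_u1:
  assumes i: "i \<in> {1..n}" and t: "t \<in> {0..<T}"
  shows "uu lam 1 t \<le> uu lam i t"
proof -
  have "uu lam i 0 / uu lam 1 0 \<le> uu lam i t / uu lam 1 t"
    by (rule nonneg_deriv_imp_ge_initial[OF ratio_deriv[OF i] _ t])
       (use lam0_min[OF i] in auto)
  then show ?thesis using u_pos[of 1 t] by (simp add: u_initial)
qed

text \<open>The quotients by \<open>uu lam 1\<close> have proportional derivatives, so a suitable
  combination of them is constant. The cross-multiplied form stays valid when
  \<open>lam0 j = lam0 1\<close>.\<close>

lemma u_linear_relation:
  assumes i: "i \<in> {1..n}" and j: "j \<in> {1..n}" and t: "t \<in> {0..<T}"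
  shows "(lam0 j - lam0 1) * (uu lam i t - uu lam 1 t) = (lam0 i - lam0 1) * (uu lam j t - uu lam 1 t)"
proof -
  let ?f = "\<lambda>t. (lam0 j - lam0 1) * (uu lam i t / uu lam 1 t) - (lam0 i - lam0 1) * (uu lam j t / uu lam 1 t)"
  have "(?f has_real_derivative 0) (at s within {0..<T})" if s: "s \<in> {0..<T}" for s
    by (rule DERIV_cong[OF DERIV_diff[OF DERIV_cmult[OF ratio_deriv[OF i s]] DERIV_cmult[OF ratio_deriv[OF j s]]]])
       simp
  from zero_deriv_imp_eq_initial[OF this t]
  have "?f t = lam0 j - lam0 i" by (simp add: u_initial)
  then show ?thesis using u_pos[of 1 t] by (simp add: field_simps)
qed

text \<open>The logarithmic derivative of the product is the sum of the \<open>lam i\<close>,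
  exactly opposite to that of \<open>rho\<close>.\<close>

lemma rho_prod:
  assumes t: "t \<in> {0..<T}"
  shows "rho t * (\<Prod>i=1..n. uu lam i t) = rho0"
proof -
  have D: "((\<lambda>t. \<Prod>i\<in>I. uu lam i t) has_real_derivative (\<Sum>i\<in>I. lam i s) * (\<Prod>i\<in>I. uu lam i s))
        (at s within {0..<T})"
    if "I \<subseteq> {1..n}" "s \<in> {0..<T}" for I s
    using finite_subset[OF that(1) finite_atLeastAtMost] that(1)
  proof (induction I rule: finite_induct)
    case (insert i I)
    then have "i \<in> {1..n}"
      and IH: "((\<lambda>t. \<Prod>i\<in>I. uu lam i t) has_real_derivative (\<Sum>i\<in>I. lam i s) * (\<Prod>i\<in>I. uu lam i s))
        (at s within {0..<T})" by auto
    from DERIV_mult[OF u_deriv[OF this(1) that(2)] this(2)]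
    show ?case using insert by (simp add: algebra_simps)
  qed simp
  have "((\<lambda>t. rho t * (\<Prod>i=1..n. uu lam i t)) has_real_derivative 0) (at s within {0..<T})"
    if s: "s \<in> {0..<T}" for s
    by (rule DERIV_cong[OF DERIV_mult[OF rho_deriv[OF s] D[OF subset_refl s]]]) simp
  from zero_deriv_imp_eq_initial[OF this t] show ?thesis
    by (simp add: u_initial rho_initial)
qed

lemma rho_pos: "t \<in> {0..<T} \<Longrightarrow> rho t > 0"
  using rho_prod[of t] rho0pos u_pos prod_pos[of "{1..n}" "\<lambda>i. uu lam i t"]
  by (metis zero_less_mult_pos2)

text \<open>The bounds follow in a chain: all \<open>uu lam i\<close> are at least \<open>c\<close>,
  so the product formula bounds \<open>rho\<close>; dropping the negative square bounds
  \<open>lam i\<close> from above; hence \<open>uu lam i\<close> is bounded, then its second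
  derivative, then its first; dividing by \<open>c\<close> bounds \<open>lam i\<close> on both
  sides.\<close>

lemma bounded_if_u1_bounded_below:
  assumes c: "c > 0" and u1: "\<And>t. t \<in> {0..<T} \<Longrightarrow> uu lam 1 t \<ge> c"
  shows "\<exists>M. \<forall>t\<in>{0..<T}. \<bar>rho t\<bar> \<le> M \<and> (\<forall>i\<in>{1..n}. \<bar>lam i t\<bar> \<le> M)"
proof -
  have uc: "uu lam i t \<ge> c" if "i \<in> {1..n}" "t \<in> {0..<T}" for i t
    using u_ge_u1[OF that] u1[OF that(2)] by linarith
  define R where "R = rho0 / c ^ n"
  have rhoR: "rho t \<le> R" if t: "t \<in> {0..<T}" for t
  proof -
    have "(\<Prod>i=1..n. c) \<le> (\<Prod>i=1..n. uu lam i t)"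
      by (rule prod_mono) (use uc t c in \<open>auto simp: less_imp_le\<close>)
    then have "rho t * c ^ n \<le> rho t * (\<Prod>i=1..n. uu lam i t)"
      using rho_pos[OF t] by (intro mult_left_mono) auto
    then show ?thesis using c unfolding rho_prod[OF t] by (simp add: R_def field_simps)
  qed
  define B where "B = k / real n * (R + cb)"
  have R0: "R > 0" using rho0pos c by (simp add: R_def)
  have g: "\<bar>k / real n * (rho t - cb)\<bar> \<le> B" if t: "t \<in> {0..<T}" for t
    unfolding B_def abs_mult using rhoR[OF t] rho_pos[OF t] cbpos kpos
    by (intro mult_mono) auto
  have B0: "B \<ge> 0" using R0 kpos cbpos by (simp add: B_def)
  define m where "m = Max ((\<lambda>i. \<bar>lam0 i\<bar>) ` {1..n})"
  have m: "\<bar>lam0 i\<bar> \<le> m" if "i \<in> {1..n}" for i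
    unfolding m_def by (rule Max_ge) (use that in auto)
  have m0: "m \<ge> 0" using m[OF one_in] by linarith
  define A where "A = m + B * T"
  have lamA: "lam i t \<le> A" if i: "i \<in> {1..n}" and t: "t \<in> {0..<T}" for i t
  proof -
    have "B * 0 - lam i 0 \<le> B * t - lam i t"
    proof (rule nonneg_deriv_imp_ge_initial[OF _ _ t])
      fix s assume s: "s \<in> {0..<T}"
      show "((\<lambda>t. B * t - lam i t) has_real_derivative
              B - (- ((lam i s)^2) + k / real n * (rho s - cb))) (at s within {0..<T})"
        by (rule DERIV_diff[OF DERIV_cmult_Id lam_deriv[OF i s]])
      show "B - (- ((lam i s)^2) + k / real n * (rho s - cb)) \<ge> 0"
        using g[OF s] zero_le_power2[of "lam i s"] by linarith
    qed
    moreover have "B * t \<le> B * T" using t B0 by (intro mult_left_mono) auto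
    ultimately show ?thesis using m[OF i] lam_initial[OF i] by (simp add: A_def)
  qed
  have A0: "A \<ge> 0" using m0 B0 Tpos by (simp add: A_def)
  define U where "U = exp (A * T)"
  have uU: "uu lam i t \<le> U" if i: "i \<in> {1..n}" and t: "t \<in> {0..<T}" for i t
  proof -
    have "integral {0..t} (lam i) \<le> integral {0..t} (\<lambda>_. A)"
      by (intro integral_le integrable_continuous_real continuous_on_subset[OF lam_continuous[OF i]])
         (use lamA i t in auto)
    also have "\<dots> = t * A" using t by simp
    also have "\<dots> \<le> T * A" using t A0 by (intro mult_right_mono) auto
    finally show ?thesis by (simp add: uu_def U_def mult.commute)
  qed
  define V where "V = m + B * U * T"
  have lamV: "\<bar>lam i t\<bar> \<le> V / c" if i: "i \<in> {1..n}" and t: "t \<in> {0..<T}" for i t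
  proof -
    have "norm (lam i t * uu lam i t - lam i 0 * uu lam i 0) \<le> (B * U) * norm (t - 0)"
    proof (rule field_differentiable_bound[of "{0..<T}" "\<lambda>t. lam i t * uu lam i t", OF _ du_deriv[OF i]])
      fix s assume s: "s \<in> {0..<T}"
      show "norm (k / real n * (rho s - cb) * uu lam i s) \<le> B * U"
        unfolding norm_mult using g[OF s] uU[OF i s] u_pos[of i s] B0
        by (intro mult_mono) (auto simp: abs_mult)
    qed (use t in auto)
    also have "\<dots> \<le> B * U * T" using t B0 by (intro mult_left_mono) (auto simp: U_def)
    finally have "\<bar>lam i t * uu lam i t\<bar> \<le> V"
      using m[OF i] lam_initial[OF i] by (simp add: u_initial V_def)
    moreover have "\<bar>lam i t\<bar> * c \<le> \<bar>lam i t\<bar> * uu lam i t"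
      using uc[OF i t] by (intro mult_left_mono) auto
    ultimately show ?thesis using c u_pos[of i t] by (simp add: field_simps abs_mult)
  qed
  show ?thesis
  proof (intro exI[of _ "max R (V / c)"] ballI conjI)
    show "\<bar>rho t\<bar> \<le> max R (V / c)" if "t \<in> {0..<T}" for t
      using rhoR[OF that] rho_pos[OF that] by simp
    show "\<bar>lam i t\<bar> \<le> max R (V / c)" if "t \<in> {0..<T}" "i \<in> {1..n}" for t i
      using lamV[OF that(2,1)] by simp
  qed
qed

lemma u1_bounded_below_extends:
  assumes "c > 0" "\<And>t. t \<in> {0..<T} \<Longrightarrow> uu lam 1 t \<ge> c"
  shows "\<exists>T'>T. \<exists>lam' rho'. is_sol n k cb rho0 lam0 lam' rho' T'"
proof -
  obtain M where "\<forall>t\<in>{0..<T}. \<bar>rho t\<bar> \<le> M \<and> (\<forall>i\<in>{1..n}. \<bar>lam i t\<bar> \<le> M)"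
    using bounded_if_u1_bounded_below[OF assms] by blast
  then show ?thesis
    using bounded_solution_extends[OF _ _ _ Tpos sol, of M] n2 kpos cbpos by auto
qed

text \<open>Conservation of energy: the repulsive potential is unbounded at \<open>u\<^sub>1 = 0\<close> because \<open>n \<ge> 2\<close>.\<close>

lemma u1_bounded_below_if_equal_data:
  assumes eq: "\<And>i. i \<in> {1..n} \<Longrightarrow> lam0 i = lam0 1"
  shows "\<exists>c>0. \<forall>t\<in>{0..<T}. uu lam 1 t \<ge> c"
proof -
  \<comment> \<open>An antiderivative of \<open>y^(1-n)\<close>, logarithmic exactly when
    \<open>n = 2\<close>; it tends to minus infinity as \<open>y\<close> decreases to
    \<open>0\<close>.\<close>
  define H where "H y = (if n = 2 then ln y else - 1 / (real (n - 2) * y ^ (n - 2)))" for y :: real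
  have H_deriv: "(H has_real_derivative 1 / y ^ (n - 1)) (at y)" if "y > 0" for y
  proof (cases "n = 2")
    case True
    then have "H = ln" by (simp add: H_def fun_eq_iff)
    then show ?thesis using that True by (auto intro!: derivative_eq_intros simp: field_simps)
  next
    case False
    then obtain m where m: "n = Suc (Suc (Suc m))" using n2
      by (metis One_nat_def Suc_1 Suc_le_D le_antisym not_less_eq_eq)
    have "H = (\<lambda>y. - 1 / (real (Suc m) * y ^ Suc m))" by (simp add: H_def fun_eq_iff m)
    moreover have "((\<lambda>y. - 1 / (real (Suc m) * y ^ Suc m)) has_real_derivative 1 / y ^ (n - 1)) (at y)"
      by (rule derivative_eq_intros refl | use that in \<open>simp add: m; fail\<close>)+
    ultimately show ?thesis by simp
  qed
  have u_eq: "uu lam i t = uu lam 1 t" if "i \<in> {1..n}" "t \<in> {0..<T}" for i t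
  proof -
    have "uu lam i t / uu lam 1 t = uu lam i 0 / uu lam 1 0"
      by (rule zero_deriv_imp_eq_initial[OF _ that(2)])
         (use ratio_deriv[OF that(1)] eq[OF that(1)] in auto)
    then show ?thesis using u_pos[of 1 t] by (simp add: u_initial)
  qed
  have rho: "rho t * (uu lam 1 t) ^ n = rho0" if "t \<in> {0..<T}" for t
  proof -
    have "(\<Prod>i=1..n. uu lam i t) = (\<Prod>i=1..n. uu lam 1 t)"
      by (rule prod.cong[OF refl]) (rule u_eq[OF _ that])
    then show ?thesis using rho_prod[OF that] by simp
  qed
  define E where "E t = (lam 1 t * uu lam 1 t)^2 / 2 + k / real n * cb * (uu lam 1 t)^2 / 2
      - k / real n * rho0 * H (uu lam 1 t)" for t
  have "(E has_real_derivative 0) (at s within {0..<T})" if s: "s \<in> {0..<T}" for s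
  proof -
    let ?v = "uu lam 1 s" and ?l = "lam 1 s"
    have v: "?v > 0" by (rule u_pos)
    have D: "(E has_real_derivative (2 * (?l * ?v) * (k / real n * (rho s - cb) * ?v)) / 2
        + k / real n * cb * (2 * ?v * (?l * ?v)) / 2
        - k / real n * rho0 * (1 / ?v ^ (n - 1) * (?l * ?v))) (at s within {0..<T})"
      unfolding E_def[abs_def]
      by (rule DERIV_cong[OF DERIV_diff[OF DERIV_add[OF
              DERIV_cdivide[OF DERIV_power[OF du_deriv[OF one_in s], where n = 2]]
              DERIV_cdivide[OF DERIV_cmult[OF DERIV_power[OF u_deriv[OF one_in s], where n = 2]]]]
              DERIV_cmult[OF DERIV_chain2[OF H_deriv[OF v] u_deriv[OF one_in s]]]]]) (simp add: mult_ac)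
    have "rho0 * (1 / ?v ^ (n - 1)) = rho s * ?v"
      using rho[OF s] v n2 by (cases n) (auto simp: field_simps)
    then have e: "k / real n * rho0 * (1 / ?v ^ (n - 1) * (?l * ?v)) = k / real n * (rho s * ?v) * (?l * ?v)"
      by (metis mult.assoc)
    show ?thesis by (rule DERIV_cong[OF D], unfold e) (use n2 in \<open>simp add: field_simps\<close>)
  qed
  then have E: "E t = E 0" if "t \<in> {0..<T}" for t
    using zero_deriv_imp_eq_initial that by blast
  define b where "b = E 0 * real n / (k * rho0)"
  have Hb: "H (uu lam 1 t) \<ge> - b" if t: "t \<in> {0..<T}" for t
  proof -
    have "E 0 + k / real n * rho0 * H (uu lam 1 t)
        = (lam 1 t * uu lam 1 t)^2 / 2 + k / real n * cb * (uu lam 1 t)^2 / 2"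
      using E[OF t] by (simp add: E_def)
    also have "\<dots> \<ge> 0" using kpos cbpos by simp
    finally show ?thesis using kpos rho0pos n2 by (simp add: b_def field_simps)
  qed
  have "\<exists>c>0. \<forall>y>0. H y \<ge> - b \<longrightarrow> y \<ge> c"
  proof (cases "n = 2")
    case True
    then show ?thesis by (intro exI[of _ "exp (- b)"]) (auto simp: H_def ln_ge_iff)
  next
    case False
    \<comment> \<open>The maximum makes \<open>b'\<close> positive, so that the claimed bound
      \<open>1 / (real (n - 2) * b')\<close> is positive. For \<open>y < 1\<close> it follows from
      \<open>y^(n-2) \<le> y\<close>.\<close>
    define b' where "b' = max 1 b"
    have "y \<ge> min 1 (1 / (real (n - 2) * b'))" if y: "y > 0" "H y \<ge> - b" for y
    proof (cases "y < 1")
      case True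
      have n3: "n - 2 \<ge> 1" using n2 False by simp
      have "1 / (real (n - 2) * y ^ (n - 2)) \<le> b'" using y False by (simp add: H_def b'_def le_max_iff_disj)
      moreover have "real (n - 2) > 0" "b' > 0" "y ^ (n - 2) > 0" using n3 y by (auto simp: b'_def)
      ultimately have "1 / (real (n - 2) * b') \<le> y ^ (n - 2)"
        by (simp add: pos_divide_le_eq mult_ac del: of_nat_diff)
      also have "\<dots> \<le> y" using power_decreasing[OF n3, of y] True y by simp
      finally show ?thesis by (rule min.coboundedI2)
    qed (auto simp: min_le_iff_disj)
    moreover have "min 1 (1 / (real (n - 2) * b')) > 0" using n2 False by (simp add: b'_def)
    ultimately show ?thesis by blast
  qed
  then show ?thesis using Hb u_pos by blast
qed

end

section \<open>Behaviour of the product of two balanced solutions\<close>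

lemma eventually_at_left_obtain:
  fixes T b :: real
  assumes "eventually Q (at_left T)" "b < T"
  obtains a where "b < a" "a < T" "\<And>t. t \<in> {a<..<T} \<Longrightarrow> Q t"
proof -
  obtain c where c: "c < T" "\<And>t. c < t \<Longrightarrow> t < T \<Longrightarrow> Q t"
    using assms(1) by (auto simp: eventually_at_left_field)
  show thesis
    by (rule that[of "max c ((b + T) / 2)"]) (use c assms(2) in \<open>auto simp: less_max_iff_disj\<close>)
qed

lemma eventually_at_left_Ioo:
  fixes T b :: real
  assumes "b < T" "\<And>t. t \<in> {b<..<T} \<Longrightarrow> Q t"
  shows "eventually Q (at_left T)"
  using assms by (auto simp: eventually_at_left_field)

lemma deriv_nonneg_Ioo_mono:
  fixes f :: "real \<Rightarrow> real"
  assumes "\<And>t. t \<in> {a<..<T} \<Longrightarrow> (f has_real_derivative f' t) (at t)"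
    and "\<And>t. t \<in> {a<..<T} \<Longrightarrow> f' t \<ge> 0"
    and "a < s" "s \<le> t" "t < T"
  shows "f s \<le> f t"
  by (rule DERIV_nonneg_imp_nondecreasing[OF assms(4)]) (use assms in force)

lemma deriv_nonpos_Ioo_antimono:
  fixes f :: "real \<Rightarrow> real"
  assumes "\<And>t. t \<in> {a<..<T} \<Longrightarrow> (f has_real_derivative f' t) (at t)"
    and "\<And>t. t \<in> {a<..<T} \<Longrightarrow> f' t \<le> 0"
    and "a < s" "s \<le> t" "t < T"
  shows "f t \<le> f s"
  by (rule DERIV_nonpos_imp_nonincreasing[OF assms(4)]) (use assms in force)

text \<open>If \<open>P'\<close> were never negative, \<open>P\<close> would not fall below a
  positive value and could not tend to \<open>0\<close>. Once \<open>P'\<close> is negative,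
  concavity keeps it below that value.\<close>

lemma concave_vanishing_slope:
  fixes P P' P'' :: "real \<Rightarrow> real"
  assumes aT: "a < T"
    and P: "\<And>t. t \<in> {a<..<T} \<Longrightarrow> (P has_real_derivative P' t) (at t)"
    and P': "\<And>t. t \<in> {a<..<T} \<Longrightarrow> (P' has_real_derivative P'' t) (at t)"
    and pos: "\<And>t. t \<in> {a<..<T} \<Longrightarrow> P t > 0"
    and concave: "\<And>t. t \<in> {a<..<T} \<Longrightarrow> P'' t \<le> 0"
    and lim: "(P \<longlongrightarrow> 0) (at_left T)"
  obtains c t1 where "c > 0" "a < t1" "t1 < T" "\<And>t. t \<in> {t1..<T} \<Longrightarrow> P' t \<le> - c"
proof -
  have "\<exists>t1\<in>{a<..<T}. P' t1 < 0"
  proof (rule ccontr)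
    assume "\<not> ?thesis"
    then have nn: "P' t \<ge> 0" if "t \<in> {a<..<T}" for t
      using that by (meson not_le)
    define m where "m = (a + T) / 2"
    have m: "a < m" "m < T" using aT by (auto simp: m_def)
    have "eventually (\<lambda>t. P m \<le> P t) (at_left T)"
      by (rule eventually_at_left_Ioo[OF m(2)]) (use deriv_nonneg_Ioo_mono[where a = a and T = T, OF P nn m(1)] in auto)
    then have "P m \<le> 0" using tendsto_lowerbound[OF lim] by simp
    then show False using pos[of m] m by auto
  qed
  then obtain t1 where t1: "a < t1" "t1 < T" "P' t1 < 0" by auto
  show thesis
    by (rule that[of "- P' t1" t1])
       (use t1 deriv_nonpos_Ioo_antimono[where a = a and T = T, OF P' concave t1(1)] in auto)
qed

text \<open>Under \<open>P P'' \<ge> K\<close> the quantity \<open>P'\<^sup>2 / 2 - K ln P\<close> decreases, whereas \<open>- K ln P\<close> is unbounded.\<close>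

lemma strongly_convex_not_vanishing:
  fixes P P' P'' :: "real \<Rightarrow> real"
  assumes aT: "a < T" and K: "K > 0"
    and P: "\<And>t. t \<in> {a<..<T} \<Longrightarrow> (P has_real_derivative P' t) (at t)"
    and P': "\<And>t. t \<in> {a<..<T} \<Longrightarrow> (P' has_real_derivative P'' t) (at t)"
    and pos: "\<And>t. t \<in> {a<..<T} \<Longrightarrow> P t > 0"
    and convex: "\<And>t. t \<in> {a<..<T} \<Longrightarrow> P t * P'' t \<ge> K"
    and lim: "(P \<longlongrightarrow> 0) (at_left T)" and lim': "(P' \<longlongrightarrow> 0) (at_left T)"
  shows False
proof -
  have "P'' t \<ge> 0" if "t \<in> {a<..<T}" for t
    using convex[OF that] K pos[OF that] by (metis less_eq_real_def less_le_trans zero_less_mult_pos)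
  note mono = deriv_nonneg_Ioo_mono[where a = a and T = T, OF P' this]
  have P'_le: "P' t \<le> 0" if t: "t \<in> {a<..<T}" for t
  proof (rule tendsto_lowerbound[OF lim'])
    show "eventually (\<lambda>s. P' t \<le> P' s) (at_left T)"
      by (rule eventually_at_left_Ioo[of t]) (use t mono in auto)
  qed simp
  define F where "F t = (P' t)^2 / 2 - K * ln (P t)" for t
  have F: "(F has_real_derivative P' t * P'' t - K * (P' t / P t)) (at t)" if t: "t \<in> {a<..<T}" for t
    unfolding F_def[abs_def] using P[OF t] P'[OF t] pos[OF t]
    by (auto intro!: derivative_eq_intros simp: field_simps)
  have "P' t * P'' t - K * (P' t / P t) \<le> 0" if t: "t \<in> {a<..<T}" for t
  proof -
    have "P' t * P'' t - K * (P' t / P t) = P' t * (P t * P'' t - K) / P t"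
      using pos[OF t] by (simp add: field_simps)
    also have "\<dots> \<le> 0"
      using P'_le[OF t] convex[OF t] pos[OF t]
      by (intro divide_nonpos_pos mult_nonpos_nonneg) auto
    finally show ?thesis .
  qed
  note anti = deriv_nonpos_Ioo_antimono[where a = a and T = T, OF F this]
  define m where "m = (a + T) / 2"
  have m: "a < m" "m < T" using aT by (auto simp: m_def)
  have "eventually (\<lambda>t. exp (- F m / K) \<le> P t) (at_left T)"
  proof (rule eventually_at_left_Ioo[OF m(2)])
    fix t assume t: "t \<in> {m<..<T}"
    then have t': "t \<in> {a<..<T}" using m by auto
    have "F t \<le> F m" using anti[of m t] t m by auto
    moreover have "- K * ln (P t) \<le> F t" by (simp add: F_def)
    ultimately have "- F m / K \<le> ln (P t)" using K by (simp add: field_simps)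
    then show "exp (- F m / K) \<le> P t" using pos[OF t'] by (simp add: ln_ge_iff)
  qed
  then have "exp (- F m / K) \<le> 0" by (rule tendsto_lowerbound[OF lim]) simp
  then show False by (simp add: not_le[symmetric])
qed

text \<open>A bounded derivative makes \<open>f\<close> Lipschitz, hence uniformly continuous, so it
  extends to the closure of the interval.\<close>

lemma bounded_deriv_imp_left_limit:
  fixes f :: "real \<Rightarrow> real"
  assumes aT: "a < T" and f: "\<And>t. t \<in> {a<..<T} \<Longrightarrow> (f has_real_derivative f' t) (at t)"
    and bd: "\<And>t. t \<in> {a<..<T} \<Longrightarrow> \<bar>f' t\<bar> \<le> B"
  obtains l where "(f \<longlongrightarrow> l) (at_left T)"
proof -
  have "B \<ge> 0" using bd[of "(a + T) / 2"] aT by (auto simp: abs_le_iff)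
  have "B-lipschitz_on {a<..<T} f"
  proof (rule lipschitz_onI)
    fix x y assume "x \<in> {a<..<T}" "y \<in> {a<..<T}"
    then show "dist (f x) (f y) \<le> B * dist x y"
      unfolding dist_norm
      by (intro field_differentiable_bound[of "{a<..<T}" f f'])
         (use f bd in \<open>auto intro: has_field_derivative_at_within\<close>)
  qed fact
  moreover have "T \<in> closure {a<..<T}" using aT by simp
  ultimately obtain l where "(f \<longlongrightarrow> l) (at T within {a<..<T})"
    using uniformly_continuous_on_extension_at_closure[OF lipschitz_on_uniformly_continuous] by blast
  moreover have "at T within {a<..<T} = at_left T"
    by (rule at_within_nhd[of _ "{a<..}"]) (use aT in auto)
  ultimately show thesis using that by simp
qed

text \<open>Abstracts \<open>u_1\<close>, \<open>u_n\<close> and their common equation. Balance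
  means that the Wronskian \<open>2 * p\<close> splits evenly in the limit: \<open>v w'\<close>
  tends to \<open>p\<close>, hence \<open>v' w\<close> to \<open>-p\<close>.\<close>

locale balanced_pair =
  fixes v w v' w' g :: "real \<Rightarrow> real" and T p :: real
  assumes Tpos: "T > 0" and ppos: "p > 0"
    and v_pos: "\<And>t. v t > 0" and w_pos: "\<And>t. w t > 0"
    and v_cont: "continuous_on {0..<T} v"
    and v_deriv: "\<And>t. t \<in> {0<..<T} \<Longrightarrow> (v has_real_derivative v' t) (at t)"
    and w_deriv: "\<And>t. t \<in> {0<..<T} \<Longrightarrow> (w has_real_derivative w' t) (at t)"
    and v'_deriv: "\<And>t. t \<in> {0<..<T} \<Longrightarrow> (v' has_real_derivative g t * v t) (at t)"
    and w'_deriv: "\<And>t. t \<in> {0<..<T} \<Longrightarrow> (w' has_real_derivative g t * w t) (at t)"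
    and wronskian: "\<And>t. t \<in> {0<..<T} \<Longrightarrow> v t * w' t - v' t * w t = 2 * p"
    and vw'_lim: "((\<lambda>t. v t * w' t) \<longlongrightarrow> p) (at_left T)"
    and v_small: "\<And>c. c > 0 \<Longrightarrow> \<exists>t\<in>{0..<T}. v t < c"
begin

lemma ev_Ioo: "eventually (\<lambda>t. t \<in> {0<..<T}) (at_left T)"
  by (rule eventually_at_left_Ioo[OF Tpos])

lemma v'w_lim: "((\<lambda>t. v' t * w t) \<longlongrightarrow> - p) (at_left T)"
proof (rule Lim_transform_eventually)
  show "((\<lambda>t. v t * w' t - 2 * p) \<longlongrightarrow> - p) (at_left T)"
    by (rule tendsto_eq_intros vw'_lim refl)+ simp
  show "eventually (\<lambda>t. v t * w' t - 2 * p = v' t * w t) (at_left T)"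
    using ev_Ioo by eventually_elim (use wronskian in force)
qed

text \<open>\<open>v_small\<close> only says that small values occur somewhere. Near
  \<open>T\<close> the product \<open>v' w\<close> is negative, so \<open>v\<close> decreases there
  and remains small once it is small.\<close>

lemma v_lim: "(v \<longlongrightarrow> 0) (at_left T)"
proof -
  have "eventually (\<lambda>t. v' t * w t < 0) (at_left T)"
    by (rule order_tendstoD[OF v'w_lim]) (use ppos in simp)
  then obtain a where a: "0 < a" "a < T" "\<And>t. t \<in> {a<..<T} \<Longrightarrow> v' t * w t < 0"
    using eventually_at_left_obtain[OF _ Tpos] by blast
  have v'neg: "v' t \<le> 0" if "t \<in> {a<..<T}" for t
    using a(3)[OF that] w_pos[of t] by (simp add: mult_less_0_iff)
  have vd: "(v has_real_derivative v' t) (at t)" if "t \<in> {a<..<T}" for t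
    using v_deriv[of t] that a by auto
  define b where "b = (a + T) / 2"
  have b: "a < b" "b < T" using a by (auto simp: b_def)
  have "\<exists>x\<in>{0..b}. \<forall>y\<in>{0..b}. v x \<le> v y"
    by (rule continuous_attains_inf) (use a b in \<open>auto intro: continuous_on_subset[OF v_cont]\<close>)
  then obtain x where x: "\<And>y. y \<in> {0..b} \<Longrightarrow> v x \<le> v y" by blast
  show ?thesis
  proof (rule order_tendstoI)
    fix e :: real assume "e < 0"
    then show "eventually (\<lambda>t. e < v t) (at_left T)"
      using less_trans[OF _ v_pos] by (intro always_eventually allI) blast
  next
    fix e :: real assume "0 < e"
    \<comment> \<open>Since \<open>v x\<close> is the minimum of \<open>v\<close> on
      \<open>[0, b]\<close>, a value below it can only occur after \<open>b\<close>, where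
      \<open>v\<close> decreases.\<close>
    then obtain t0 where t0: "t0 \<in> {0..<T}" "v t0 < min e (v x)"
      using v_small[of "min e (v x)"] v_pos[of x] by auto
    have "b < t0" using x[of t0] t0 by force
    show "eventually (\<lambda>t. v t < e) (at_left T)"
    proof (rule eventually_at_left_Ioo[of t0])
      fix t assume "t \<in> {t0<..<T}"
      then have "v t \<le> v t0"
        using deriv_nonpos_Ioo_antimono[where a = a and T = T, OF vd v'neg, of t0 t] \<open>b < t0\<close> b by auto
      then show "v t < e" using t0 by simp
    qed (use t0 in simp)
  qed
qed

section \<open>The product P of the pair and its second-order equation\<close>

definition "P t = v t * w t"
definition "P' t = v' t * w t + v t * w' t"
definition "P'' t = 2 * g t * P t + 2 * (v' t * w' t)"
definition "Q t = 2 * g t * (P t)^2"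

lemma P_pos: "P t > 0"
  by (simp add: P_def v_pos w_pos)

lemma P_deriv: "t \<in> {0<..<T} \<Longrightarrow> (P has_real_derivative P' t) (at t)"
  unfolding P_def[abs_def] P'_def
  by (rule DERIV_cong[OF DERIV_mult[OF v_deriv w_deriv]]) (auto simp: algebra_simps)

lemma P'_deriv: "t \<in> {0<..<T} \<Longrightarrow> (P' has_real_derivative P'' t) (at t)"
  unfolding P'_def[abs_def] P''_def P_def
  by (rule DERIV_cong[OF DERIV_add[OF DERIV_mult[OF v'_deriv w_deriv] DERIV_mult[OF v_deriv w'_deriv]]])
     (auto simp: algebra_simps)

text \<open>The mixed term is eliminated by
  \<open>4 v v' w w' = (v' w + v w')^2 - (v w' - v' w)^2\<close>, whose last square is
  \<open>(2 p)^2\<close>.\<close>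

lemma P_P'': "t \<in> {0<..<T} \<Longrightarrow> P t * P'' t = Q t + (P' t)^2 / 2 - 2 * p^2"
proof -
  assume t: "t \<in> {0<..<T}"
  have p: "p = (v t * w' t - v' t * w t) / 2" using wronskian[OF t] by simp
  show ?thesis unfolding p Q_def P''_def P'_def P_def by (simp add: field_simps power2_eq_square)
qed

lemma P'_lim: "(P' \<longlongrightarrow> 0) (at_left T)"
  unfolding P'_def[abs_def] using tendsto_add[OF v'w_lim vw'_lim] by simp

text \<open>If \<open>P\<close> stayed away from \<open>0\<close>, then \<open>(ln v)' = v' w / P\<close> would be bounded, against \<open>v \<rightarrow> 0\<close>.\<close>

lemma P_lim: "(P \<longlongrightarrow> 0) (at_left T)"
proof (rule order_tendstoI)
  fix e :: real assume "e < 0"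
  then show "eventually (\<lambda>t. e < P t) (at_left T)"
    using less_trans[OF _ P_pos] by (intro always_eventually allI) blast
next
  fix e :: real assume e: "0 < e"
  have "eventually (\<lambda>t. P' t > - 1 \<and> v' t * w t > - 2 * p) (at_left T)"
    by (intro eventually_conj order_tendstoD[OF P'_lim] order_tendstoD[OF v'w_lim])
       (use ppos in auto)
  moreover have "max 0 (T - e / 2) < T" using e Tpos by simp
  ultimately obtain a where a: "max 0 (T - e / 2) < a" "a < T"
    "\<And>t. t \<in> {a<..<T} \<Longrightarrow> P' t > - 1 \<and> v' t * w t > - 2 * p"
    using eventually_at_left_obtain by blast
  have sub: "t \<in> {0<..<T}" if "t \<in> {a<..<T}" for t using that a by auto
  show "eventually (\<lambda>t. P t < e) (at_left T)"
  proof (rule eventually_at_left_Ioo[OF a(2)], rule ccontr)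
    fix t1 assume t1: "t1 \<in> {a<..<T}" and "\<not> P t1 < e"
    then have Pt1: "P t1 \<ge> e" by simp
    \<comment> \<open>With slope above \<open>-1\<close> and less than \<open>e / 2\<close> of time
      left, \<open>P\<close> cannot fall from \<open>e\<close> below \<open>e / 2\<close>.\<close>
    have Pge: "P s \<ge> e / 2" if s: "s \<in> {t1<..<T}" for s
    proof -
      have "P t1 + t1 \<le> P s + s"
        by (rule deriv_nonneg_Ioo_mono[where f = "\<lambda>s. P s + s" and f' = "\<lambda>s. P' s + 1" and a = a and T = T])
           (use a(3) sub s t1 in \<open>force intro!: DERIV_add P_deriv DERIV_ident\<close>)+
      then show ?thesis using Pt1 s a t1 by auto
    qed
    define m where "m = (t1 + T) / 2"
    have m: "t1 < m" "m < T" using t1 by (auto simp: m_def)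
    \<comment> \<open>The lower bound for \<open>ln v\<close> obtained by integrating
      \<open>(ln v)' \<ge> - 4 p / e\<close> from \<open>m\<close> to \<open>T\<close>.\<close>
    define c where "c = ln (v m) - 4 * p / e * (T - m)"
    have "eventually (\<lambda>s. exp c \<le> v s) (at_left T)"
    proof (rule eventually_at_left_Ioo[OF m(2)])
      fix s assume s: "s \<in> {m<..<T}"
      have "ln (v m) + 4 * p / e * m \<le> ln (v s) + 4 * p / e * s"
      proof (rule deriv_nonneg_Ioo_mono[where f = "\<lambda>s. ln (v s) + 4 * p / e * s" and a = t1 and T = T])
        fix x assume x: "x \<in> {t1<..<T}"
        then have x': "x \<in> {a<..<T}" using t1 by auto
        show "((\<lambda>s. ln (v s) + 4 * p / e * s) has_real_derivative v' x / v x + 4 * p / e) (at x)"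
          using v_deriv[OF sub[OF x']] v_pos[of x] e by (auto intro!: derivative_eq_intros)
        have "- (v' x / v x) = (- (v' x * w x)) / P x"
          using v_pos[of x] w_pos[of x] by (simp add: P_def field_simps)
        also have "\<dots> \<le> (2 * p) / (e / 2)"
          using a(3)[OF x'] Pge[OF x] e ppos by (intro frac_le) auto
        finally show "v' x / v x + 4 * p / e \<ge> 0" by simp
      qed (use m s in auto)
      moreover have "4 * p / e * s \<le> 4 * p / e * T" using s ppos e by (intro mult_left_mono) auto
      ultimately have "c \<le> ln (v s)" by (simp add: c_def right_diff_distrib)
      then show "exp c \<le> v s" using v_pos[of s] by (simp add: ln_ge_iff)
    qed
    then have "exp c \<le> 0" by (rule tendsto_lowerbound[OF v_lim]) simp
    then show False by (simp add: not_le[symmetric])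
  qed
qed

section \<open>Logarithmic asymptotics and the possible limits of Q\<close>

lemma ln_at_bot:
  assumes "(f \<longlongrightarrow> 0) (at_left T)" "\<And>t. f t > (0::real)"
  shows "filterlim (\<lambda>t. ln (f t)) at_bot (at_left T)"
proof (rule filterlim_compose[OF ln_at_0])
  have "f t \<noteq> 0" for t using assms(2)[of t] by simp
  then show "filterlim f (at_right 0) (at_left T)"
    using assms by (simp add: filterlim_at)
qed

text \<open>By L'Hopital's rule, since the quotient of the logarithmic derivatives is
  \<open>v w' / - (v' w)\<close>, which tends to \<open>p / p\<close>.\<close>

lemma ln_ratio_lim: "((\<lambda>t. ln (w t) / - ln (v t)) \<longlongrightarrow> 1) (at_left T)"
proof (rule lhopital_left_at_top)
  show "filterlim (\<lambda>t. - ln (v t)) at_top (at_left T)"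
    using ln_at_bot[OF v_lim v_pos] by (simp add: filterlim_uminus_at_bot)
  show "eventually (\<lambda>t. DERIV (\<lambda>t. ln (w t)) t :> w' t / w t) (at_left T)"
    using ev_Ioo by eventually_elim
      (use w_deriv w_pos in \<open>auto intro!: derivative_eq_intros\<close>)
  show "eventually (\<lambda>t. DERIV (\<lambda>t. - ln (v t)) t :> - (v' t / v t)) (at_left T)"
    using ev_Ioo by eventually_elim
      (use v_deriv v_pos in \<open>auto intro!: derivative_eq_intros\<close>)
  have ev: "eventually (\<lambda>t. v' t * w t < 0) (at_left T)"
    by (rule order_tendstoD[OF v'w_lim]) (use ppos in simp)
  show "eventually (\<lambda>t. - (v' t / v t) \<noteq> 0) (at_left T)"
    using ev by eventually_elim (use v_pos in \<open>auto simp: less_imp_neq[symmetric]\<close>)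
  show "((\<lambda>t. (w' t / w t) / - (v' t / v t)) \<longlongrightarrow> 1) (at_left T)"
  proof (rule Lim_transform_eventually)
    show "((\<lambda>t. (v t * w' t) / - (v' t * w t)) \<longlongrightarrow> 1) (at_left T)"
      using tendsto_divide[OF vw'_lim tendsto_minus[OF v'w_lim]] ppos by simp
    show "eventually (\<lambda>t. (v t * w' t) / - (v' t * w t) = (w' t / w t) / - (v' t / v t)) (at_left T)"
      by (intro always_eventually allI) (use v_pos w_pos in \<open>simp add: field_simps\<close>)
  qed
qed

lemma P_P''_eventually:
  assumes "eventually (\<lambda>t. R (Q t + (P' t)^2 / 2 - 2 * p^2)) (at_left T)"
  obtains a where "0 < a" "a < T" "\<And>t. t \<in> {a<..<T} \<Longrightarrow> R (P t * P'' t)"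
proof -
  have "eventually (\<lambda>t. R (P t * P'' t)) (at_left T)"
    using assms ev_Ioo by eventually_elim (simp add: P_P'')
  then show thesis using eventually_at_left_obtain[OF _ Tpos] that by blast
qed

lemma not_eventually_ge:
  assumes "K > 0" "eventually (\<lambda>t. K \<le> Q t + (P' t)^2 / 2 - 2 * p^2) (at_left T)"
  shows False
proof -
  obtain a where a: "0 < a" "a < T" "\<And>t. t \<in> {a<..<T} \<Longrightarrow> K \<le> P t * P'' t"
    using P_P''_eventually[OF assms(2)] by blast
  show False
    by (rule strongly_convex_not_vanishing[OF a(2) assms(1) P_deriv P'_deriv P_pos a(3) P_lim P'_lim])
       (use a in auto)
qed

lemma Q_not_at_top:
  assumes "filterlim Q at_top (at_left T)"
  shows False
proof (rule not_eventually_ge[of 1])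
  have "eventually (\<lambda>t. 1 + 2 * p^2 \<le> Q t) (at_left T)"
    using assms by (simp add: filterlim_at_top)
  then show "eventually (\<lambda>t. 1 \<le> Q t + (P' t)^2 / 2 - 2 * p^2) (at_left T)"
  proof eventually_elim
    case (elim t)
    then show ?case using zero_le_power2[of "P' t"] by linarith
  qed
qed simp

text \<open>A limit above \<open>2 p^2\<close> bounds \<open>P P''\<close> below by a positive
  constant, which is impossible. A limit below it makes \<open>P\<close> concave near
  \<open>T\<close>, with slope at most some \<open>-c < 0\<close>, contrary to \<open>P'\<close>
  tending to \<open>0\<close>.\<close>

lemma Q_limit_eq:
  assumes "(Q \<longlongrightarrow> L) (at_left T)"
  shows "L = 2 * p^2"
proof -
  have lim: "((\<lambda>t. Q t + (P' t)^2 / 2 - 2 * p^2) \<longlongrightarrow> L - 2 * p^2) (at_left T)"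
    by (rule tendsto_eq_intros assms P'_lim refl | simp)+
  have "\<not> L > 2 * p^2"
  proof
    assume "L > 2 * p^2"
    then have "eventually (\<lambda>t. (L - 2 * p^2) / 2 < Q t + (P' t)^2 / 2 - 2 * p^2) (at_left T)"
      by (intro order_tendstoD[OF lim]) simp
    then have "eventually (\<lambda>t. (L - 2 * p^2) / 2 \<le> Q t + (P' t)^2 / 2 - 2 * p^2) (at_left T)"
      by eventually_elim simp
    then show False using not_eventually_ge[of "(L - 2 * p^2) / 2"] \<open>L > 2 * p^2\<close> by simp
  qed
  moreover have "\<not> L < 2 * p^2"
  proof
    assume "L < 2 * p^2"
    then have "eventually (\<lambda>t. Q t + (P' t)^2 / 2 - 2 * p^2 < 0) (at_left T)"
      by (intro order_tendstoD[OF lim]) simp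
    then obtain a where a: "0 < a" "a < T" "\<And>t. t \<in> {a<..<T} \<Longrightarrow> P t * P'' t < 0"
      using P_P''_eventually[of "\<lambda>x. x < 0"] by blast
    have "P'' t \<le> 0" if "t \<in> {a<..<T}" for t
      using a(3)[OF that] P_pos[of t] by (simp add: mult_less_0_iff)
    then obtain c t1 where c: "c > 0" "a < t1" "t1 < T" "\<And>t. t \<in> {t1..<T} \<Longrightarrow> P' t \<le> - c"
      using concave_vanishing_slope[OF a(2) P_deriv P'_deriv P_pos _ P_lim] a by auto
    have "eventually (\<lambda>t. P' t \<le> - c) (at_left T)"
      by (rule eventually_at_left_Ioo[OF c(3)]) (use c in auto)
    then have "0 \<le> - c" by (rule tendsto_upperbound[OF P'_lim]) simp
    then show False using c by simp
  qed
  ultimately show ?thesis by simp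
qed

text \<open>The quotient of \<open>P^2\<close> by \<open>v / w\<close> is \<open>v w^3\<close>. Its
  derivative is \<open>w^2 (v' w + 3 v w')\<close>, where the bracket tends to
  \<open>2 p > 0\<close>, so \<open>v w^3\<close> is eventually increasing and bounded
  below.\<close>

lemma ratio_le_P_squared:
  obtains c where "c > 0" "eventually (\<lambda>t. v t / w t \<le> c * (P t)^2) (at_left T)"
proof -
  have "((\<lambda>t. v' t * w t + 3 * (v t * w' t)) \<longlongrightarrow> 2 * p) (at_left T)"
    by (rule tendsto_eq_intros v'w_lim vw'_lim refl | simp)+
  then have "eventually (\<lambda>t. v' t * w t + 3 * (v t * w' t) > 0) (at_left T)"
    by (rule order_tendstoD) (use ppos in simp)
  then obtain a where a: "0 < a" "a < T" "\<And>t. t \<in> {a<..<T} \<Longrightarrow> v' t * w t + 3 * (v t * w' t) > 0"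
    using eventually_at_left_obtain[OF _ Tpos] by blast
  define m where "m = (a + T) / 2"
  have m: "a < m" "m < T" using a by (auto simp: m_def)
  define c where "c = v m * w m ^ 3"
  have c: "c > 0" using v_pos w_pos by (simp add: c_def)
  show thesis
  proof (rule that[of "1 / c"])
    show "eventually (\<lambda>t. v t / w t \<le> 1 / c * (P t)^2) (at_left T)"
    proof (rule eventually_at_left_Ioo[OF m(2)])
      fix t assume t: "t \<in> {m<..<T}"
      have "c \<le> v t * w t ^ 3"
        unfolding c_def
      proof (rule deriv_nonneg_Ioo_mono[where f = "\<lambda>t. v t * w t ^ 3" and a = a and T = T])
        fix x assume x: "x \<in> {a<..<T}"
        show "((\<lambda>t. v t * w t ^ 3) has_real_derivative (w x)^2 * (v' x * w x + 3 * (v x * w' x))) (at x)"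
          by (rule DERIV_cong[OF DERIV_mult[OF v_deriv DERIV_power[OF w_deriv]]])
             (use x a in \<open>auto simp: algebra_simps power2_eq_square power3_eq_cube\<close>)
        show "(w x)^2 * (v' x * w x + 3 * (v x * w' x)) \<ge> 0"
          using a(3)[OF x] by simp
      qed (use m t in auto)
      then have "v t / w t * c \<le> v t / w t * (v t * w t ^ 3)"
        using v_pos[of t] w_pos[of t] by (intro mult_left_mono) (auto simp: less_imp_le)
      also have "\<dots> = (P t)^2"
        using w_pos[of t] by (simp add: P_def power2_eq_square power3_eq_cube)
      finally show "v t / w t \<le> 1 / c * (P t)^2" using c by (simp add: field_simps)
    qed
  qed (use c in simp)
qed

lemma ratio_lim: "((\<lambda>t. v t / w t) \<longlongrightarrow> 0) (at_left T)"
proof -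
  obtain c where c: "eventually (\<lambda>t. v t / w t \<le> c * (P t)^2) (at_left T)"
    using ratio_le_P_squared by blast
  have "((\<lambda>t. c * (P t)^2) \<longlongrightarrow> 0) (at_left T)"
    by (rule tendsto_eq_intros P_lim refl | simp)+
  from tendsto_sandwich[OF _ c tendsto_const this] show ?thesis
    using v_pos w_pos by (auto intro!: always_eventually simp: less_imp_le)
qed

text \<open>\<open>y = \<surd>P\<close> satisfies \<open>y'' = (Q - 2 p\<^sup>2) / (2 P \<surd>P)\<close>: it is concave with bounded second derivative.\<close>

lemma sqrt_P_asymptotics:
  assumes upper: "eventually (\<lambda>t. Q t \<le> 2 * p^2) (at_left T)"
    and lower: "eventually (\<lambda>t. 2 * p^2 - c * (P t)^2 \<le> Q t) (at_left T)"
  obtains m where "m > 0" "((\<lambda>t. sqrt (P t) / (T - t)) \<longlongrightarrow> m) (at_left T)"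
proof -
  have "eventually (\<lambda>t. Q t \<le> 2 * p^2 \<and> 2 * p^2 - c * (P t)^2 \<le> Q t \<and> P t < 1) (at_left T)"
    by (intro eventually_conj upper lower order_tendstoD[OF P_lim]) simp
  then obtain a where a: "0 < a" "a < T"
    "\<And>t. t \<in> {a<..<T} \<Longrightarrow> Q t \<le> 2 * p^2 \<and> 2 * p^2 - c * (P t)^2 \<le> Q t \<and> P t < 1"
    using eventually_at_left_obtain[OF _ Tpos] by blast
  have sub: "t \<in> {0<..<T}" if "t \<in> {a<..<T}" for t using that a by auto
  define y where "y t = sqrt (P t)" for t
  define y' where "y' t = P' t / (2 * y t)" for t
  define y'' where "y'' t = (Q t - 2 * p^2) / (2 * P t * y t)" for t
  have y_pos: "y t > 0" for t using P_pos[of t] by (simp add: y_def)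
  have y2: "y t * y t = P t" for t using P_pos[of t] by (simp add: y_def)
  have yd: "(y has_real_derivative y' t) (at t)" if t: "t \<in> {a<..<T}" for t
    using P_deriv[OF sub[OF t]] P_pos[of t] unfolding y_def[abs_def] y'_def
    by (auto intro!: derivative_eq_intros simp: field_simps)
  have y'd: "(y' has_real_derivative y'' t) (at t)" if t: "t \<in> {a<..<T}" for t
  proof -
    have D: "(y' has_real_derivative (P'' t * (2 * y t) - P' t * (2 * y' t)) / ((2 * y t) * (2 * y t))) (at t)"
      unfolding y'_def[abs_def]
      by (rule DERIV_divide[OF P'_deriv[OF sub[OF t]] DERIV_cmult[OF yd[OF t, unfolded y'_def]]])
         (use y_pos[of t] in simp)
    have "(P'' t * (2 * y t) - P' t * (2 * y' t)) / ((2 * y t) * (2 * y t))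
        = (P t * P'' t - (P' t)^2 / 2) / (2 * P t * y t)"
      using y_pos[of t] P_pos[of t] unfolding y'_def y2[symmetric]
      by (simp add: field_simps power2_eq_square)
    also have "\<dots> = y'' t" using P_P''[OF sub[OF t]] by (simp add: y''_def)
    finally show ?thesis using D by simp
  qed
  have y''_nonpos: "y'' t \<le> 0" if t: "t \<in> {a<..<T}" for t
    unfolding y''_def using a(3)[OF t] P_pos[of t] y_pos[of t]
    by (intro divide_nonpos_pos) auto
  have y''_bd: "\<bar>y'' t\<bar> \<le> \<bar>c\<bar>" if t: "t \<in> {a<..<T}" for t
  proof -
    have y1: "y t < 1" using a(3)[OF t] by (simp add: y_def)
    have "\<bar>y'' t\<bar> = - y'' t" using y''_nonpos[OF t] by simp
    also have "\<dots> = (2 * p^2 - Q t) / (2 * P t * y t)"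
      unfolding y''_def minus_divide_left by simp
    also have "\<dots> \<le> (\<bar>c\<bar> * (P t)^2) / (2 * P t * y t)"
    proof (rule divide_right_mono)
      have "c * (P t)^2 \<le> \<bar>c\<bar> * (P t)^2" by (intro mult_right_mono) auto
      then show "2 * p^2 - Q t \<le> \<bar>c\<bar> * (P t)^2" using a(3)[OF t] by linarith
    qed (use P_pos[of t] y_pos[of t] in simp)
    also have "\<dots> = \<bar>c\<bar> * (y t / 2)"
      using y_pos[of t] by (simp add: y2[symmetric] power2_eq_square field_simps)
    also have "\<dots> \<le> \<bar>c\<bar> * 1" using y1 by (intro mult_left_mono) auto
    finally show ?thesis by simp
  qed
  have y_lim: "(y \<longlongrightarrow> 0) (at_left T)"
    unfolding y_def[abs_def] using tendsto_real_sqrt[OF P_lim] by simp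
  obtain l where l: "(y' \<longlongrightarrow> l) (at_left T)"
    using bounded_deriv_imp_left_limit[OF a(2) y'd y''_bd] by blast
  obtain e t1 where e: "e > 0" "a < t1" "t1 < T" "\<And>t. t \<in> {t1..<T} \<Longrightarrow> y' t \<le> - e"
    using concave_vanishing_slope[OF a(2) yd y'd y_pos y''_nonpos y_lim] by blast
  have "eventually (\<lambda>t. y' t \<le> - e) (at_left T)"
    by (rule eventually_at_left_Ioo[OF e(3)]) (use e in auto)
  then have "l \<le> - e" by (rule tendsto_upperbound[OF l]) simp
  \<comment> \<open>L'Hopital's rule reduces the rate of \<open>y\<close> to the limit of
    \<open>y'\<close>; the bound \<open>l \<le> - e\<close> makes that rate nonzero.\<close>
  moreover have "((\<lambda>t. y t / (T - t)) \<longlongrightarrow> - l) (at_left T)"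
  proof (rule lhopital_left[OF y_lim])
    show "((\<lambda>t. T - t) \<longlongrightarrow> 0) (at_left T)"
      by (rule tendsto_eq_intros refl | simp)+
    show "eventually (\<lambda>t. T - t \<noteq> 0) (at_left T)"
      using ev_Ioo by eventually_elim auto
    show "eventually (\<lambda>t. - 1 \<noteq> (0::real)) (at_left T)" by simp
    show "eventually (\<lambda>t. DERIV y t :> y' t) (at_left T)"
      by (rule eventually_at_left_Ioo[OF a(2) yd])
    show "eventually (\<lambda>t. DERIV (\<lambda>t. T - t) t :> - 1) (at_left T)"
      by (intro always_eventually allI) (auto intro!: derivative_eq_intros)
    show "((\<lambda>t. y' t / - 1) \<longlongrightarrow> - l) (at_left T)"
      using tendsto_minus[OF l] by simp
  qed
  ultimately show thesis using that[of "- l"] e(1) by (simp add: y_def)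
qed

end

section \<open>Blow-up of the full system\<close>

context flow_solution
begin

lemma n_in: "n \<in> {1..n}" using n2 by simp

lemma at_interior: "t \<in> {0<..<T} \<Longrightarrow> at t within {0..<T} = at t"
  by (rule at_within_interior) auto

lemma balanced_pair_of_flow:
  assumes d: "lam0 1 < lam0 n"
    and lim: "((\<lambda>t. uu lam 1 t * (lam n t * uu lam n t)) \<longlongrightarrow> (lam0 n - lam0 1) / 2) (at_left T)"
    and small: "\<And>c. c > 0 \<Longrightarrow> \<exists>t\<in>{0..<T}. uu lam 1 t < c"
  shows "balanced_pair (uu lam 1) (uu lam n) (\<lambda>t. lam 1 t * uu lam 1 t) (\<lambda>t. lam n t * uu lam n t)
           (\<lambda>t. k / real n * (rho t - cb)) T ((lam0 n - lam0 1) / 2)"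
proof
  show "continuous_on {0..<T} (uu lam 1)" by (rule DERIV_continuous_on[OF u_deriv[OF one_in]])
  fix t assume t: "t \<in> {0<..<T}"
  then have t': "t \<in> {0..<T}" by auto
  show "(uu lam 1 has_real_derivative lam 1 t * uu lam 1 t) (at t)"
    using u_deriv[OF one_in t'] by (simp add: at_interior[OF t])
  show "(uu lam n has_real_derivative lam n t * uu lam n t) (at t)"
    using u_deriv[OF n_in t'] by (simp add: at_interior[OF t])
  show "((\<lambda>t. lam 1 t * uu lam 1 t) has_real_derivative k / real n * (rho t - cb) * uu lam 1 t) (at t)"
    using du_deriv[OF one_in t'] by (simp add: at_interior[OF t])
  show "((\<lambda>t. lam n t * uu lam n t) has_real_derivative k / real n * (rho t - cb) * uu lam n t) (at t)"
    using du_deriv[OF n_in t'] by (simp add: at_interior[OF t])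
  show "uu lam 1 t * (lam n t * uu lam n t) - lam 1 t * uu lam 1 t * uu lam n t = 2 * ((lam0 n - lam0 1) / 2)"
    using wronskian[OF n_in t'] by (simp add: algebra_simps)
qed (use Tpos d u_pos lim small in auto)

end

text \<open>\<open>lim\<close> is the form in which \<open>p = q\<close> enters: the two limits add
  up to the Wronskian, so each is half of it. Maximality enters through
  \<open>small\<close>.\<close>

locale balanced_flow = flow_solution +
  fixes J :: nat
  assumes J1: "1 \<le> J" and Jn: "J < n"
    and low: "\<And>i. i \<in> {1..J} \<Longrightarrow> lam0 i = lam0 1"
    and high: "\<And>i. i \<in> {J+1..n} \<Longrightarrow> lam0 1 < lam0 i"
    and lim: "((\<lambda>t. uu lam 1 t * (lam n t * uu lam n t)) \<longlongrightarrow> (lam0 n - lam0 1) / 2) (at_left T)"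
    and small: "\<And>c. c > 0 \<Longrightarrow> \<exists>t\<in>{0..<T}. uu lam 1 t < c"
begin

definition "v = uu lam 1"
definition "w = uu lam n"
definition "v' t = lam 1 t * v t"
definition "w' t = lam n t * w t"
definition "g t = k / real n * (rho t - cb)"
definition "d = lam0 n - lam0 1"
text \<open>The coordinate of \<open>u_i\<close> on the line through \<open>v\<close> and
  \<open>w\<close>: \<open>u_i = (1 - a i) v + a i w\<close>.\<close>

definition "a i = (lam0 i - lam0 1) / d"

lemma d_pos: "d > 0" using high[of n] Jn by (simp add: d_def)

sublocale bp: balanced_pair v w v' w' g T "d / 2"
  unfolding d_def v'_def[abs_def] w'_def[abs_def] g_def[abs_def] v_def w_def
  by (rule balanced_pair_of_flow[OF _ lim small]) (use d_pos in \<open>simp_all add: d_def\<close>)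

lemma a_pos: "i \<in> {J+1..n} \<Longrightarrow> a i > 0"
  using high[of i] d_pos by (simp add: a_def)

lemma u_conv: "i \<in> {1..n} \<Longrightarrow> t \<in> {0..<T} \<Longrightarrow> uu lam i t = v t + a i * (w t - v t)"
  using u_linear_relation[OF _ n_in, of i t, folded v_def w_def d_def] d_pos
  by (simp add: a_def field_simps)

lemma u_low: "i \<in> {1..J} \<Longrightarrow> t \<in> {0..<T} \<Longrightarrow> uu lam i t = v t"
  using u_conv[of i t] low[of i] Jn by (simp add: a_def)

lemma rho_split:
  assumes t: "t \<in> {0..<T}"
  shows "rho t * (v t ^ J * (\<Prod>i=J+1..n. uu lam i t)) = rho0"
proof -
  have "{1..n} = {1..J} \<union> {J+1..n}" using Jn by auto
  then have "(\<Prod>i=1..n. uu lam i t) = (\<Prod>i=1..J. uu lam i t) * (\<Prod>i=J+1..n. uu lam i t)"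
    by (simp add: prod.union_disjoint)
  also have "(\<Prod>i=1..J. uu lam i t) = (\<Prod>i=1..J. v t)"
    by (rule prod.cong[OF refl]) (rule u_low[OF _ t])
  finally show ?thesis using rho_prod[OF t] by simp
qed

lemma u_ratio_lim:
  assumes i: "i \<in> {1..n}"
  shows "((\<lambda>t. uu lam i t / w t) \<longlongrightarrow> a i) (at_left T)"
proof (rule Lim_transform_eventually)
  show "((\<lambda>t. v t / w t + a i * (1 - v t / w t)) \<longlongrightarrow> a i) (at_left T)"
    by (rule tendsto_eq_intros bp.ratio_lim refl | simp)+
  show "eventually (\<lambda>t. v t / w t + a i * (1 - v t / w t) = uu lam i t / w t) (at_left T)"
    using bp.ev_Ioo
  proof eventually_elim
    case (elim t)
    then show ?case using u_conv[OF i, of t] bp.w_pos[of t] by (simp add: field_simps)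
  qed
qed

section \<open>Determination of J and n\<close>

definition "A = (\<Prod>i=J+1..n. a i)"
definition "h t = rho0 / (\<Prod>i=J+1..n. uu lam i t / w t)"
text \<open>\<open>exp (- l t)\<close> is \<open>v^(2-J) w^(2-(n-J))\<close>, the factor of
  \<open>rho P^2\<close> whose behaviour is not yet known; the other factor \<open>h\<close> has the
  positive limit \<open>rho0 / A\<close>.\<close>

definition "l t = (real J - 2) * ln (v t) + (real (n - J) - 2) * ln (w t)"

lemma A_pos: "A > 0" unfolding A_def by (rule prod_pos) (use a_pos in blast)

lemma h_lim: "(h \<longlongrightarrow> rho0 / A) (at_left T)"
proof -
  have "((\<lambda>t. \<Prod>i=J+1..n. uu lam i t / w t) \<longlongrightarrow> A) (at_left T)"
    unfolding A_def by (intro tendsto_prod u_ratio_lim) auto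
  from tendsto_divide[OF tendsto_const this] show ?thesis
    unfolding h_def[abs_def] using A_pos by simp
qed

lemma rho_P_squared:
  assumes t: "t \<in> {0..<T}"
  shows "rho t * (bp.P t)^2 = h t * exp (- l t)"
proof -
  have v: "v t > 0" and w: "w t > 0" by (rule bp.v_pos bp.w_pos)+
  define R where "R = (\<Prod>i=J+1..n. uu lam i t)"
  have R: "R > 0" unfolding R_def by (rule prod_pos) (simp add: u_pos)
  have "exp (l t) = exp (real J * ln (v t) + real (n - J) * ln (w t) - (ln (v t) + ln (v t) + (ln (w t) + ln (w t))))"
    by (simp add: l_def algebra_simps)
  also have "\<dots> = v t ^ J * w t ^ (n - J) / (v t * v t * (w t * w t))"
    using v w by (simp only: exp_diff exp_add exp_of_nat_mult exp_ln)
  finally have l: "exp (l t) = v t ^ J * w t ^ (n - J) / (bp.P t)^2"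
    by (simp add: bp.P_def power2_eq_square mult_ac)
  have "(\<Prod>i=J+1..n. uu lam i t / w t) = R / w t ^ (n - J)"
    by (simp add: prod_dividef R_def)
  then have h: "h t = rho0 * w t ^ (n - J) / R" by (simp add: h_def)
  have "rho t = rho0 / (v t ^ J * R)"
    using rho_split[OF t, folded R_def] v R by (simp add: field_simps)
  then show ?thesis
    unfolding exp_minus l h using v w R bp.P_pos[of t] by (simp add: field_simps)
qed

lemma Q_eq: "bp.Q t = 2 * k / real n * (rho t * (bp.P t)^2 - cb * (bp.P t)^2)"
  unfolding bp.Q_def g_def left_diff_distrib[symmetric] by simp

lemma Q_lim:
  assumes "((\<lambda>t. h t * exp (- l t)) \<longlongrightarrow> L) (at_left T)"
  shows "(bp.Q \<longlongrightarrow> 2 * k / real n * L) (at_left T)"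
proof (rule Lim_transform_eventually)
  show "((\<lambda>t. 2 * k / real n * (h t * exp (- l t) - cb * (bp.P t)^2)) \<longlongrightarrow> 2 * k / real n * L) (at_left T)"
    by (rule tendsto_eq_intros assms bp.P_lim refl | simp)+
  show "eventually (\<lambda>t. 2 * k / real n * (h t * exp (- l t) - cb * (bp.P t)^2) = bp.Q t) (at_left T)"
    using bp.ev_Ioo by eventually_elim (simp add: Q_eq rho_P_squared)
qed

text \<open>Otherwise \<open>Q\<close> would tend to \<open>0\<close> instead of the positive number
  \<open>2 p^2\<close>.\<close>

lemma l_not_at_top: "\<not> filterlim l at_top (at_left T)"
proof
  assume "filterlim l at_top (at_left T)"
  then have "((\<lambda>t. exp (- l t)) \<longlongrightarrow> 0) (at_left T)"
    by (intro filterlim_compose[OF exp_at_bot]) (simp add: filterlim_uminus_at_top)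
  from tendsto_mult[OF h_lim this] have "(bp.Q \<longlongrightarrow> 2 * k / real n * 0) (at_left T)"
    by (intro Q_lim) simp
  from bp.Q_limit_eq[OF this] show False using d_pos by simp
qed

text \<open>Otherwise \<open>Q\<close> would tend to infinity, making \<open>P\<close> too convex to
  vanish.\<close>

lemma l_not_at_bot: "\<not> filterlim l at_bot (at_left T)"
proof
  assume "filterlim l at_bot (at_left T)"
  then have "filterlim (\<lambda>t. exp (- l t)) at_top (at_left T)"
    by (intro filterlim_compose[OF exp_at_top]) (simp add: filterlim_uminus_at_bot)
  then have "filterlim (\<lambda>t. h t * exp (- l t)) at_top (at_left T)"
    using rho0pos A_pos by (intro filterlim_tendsto_pos_mult_at_top[OF h_lim]) auto
  moreover have "((\<lambda>t. - (cb * (bp.P t)^2)) \<longlongrightarrow> 0) (at_left T)"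
    by (rule tendsto_eq_intros bp.P_lim refl | simp)+
  ultimately have "filterlim (\<lambda>t. - (cb * (bp.P t)^2) + h t * exp (- l t)) at_top (at_left T)"
    by (intro filterlim_tendsto_add_at_top)
  then have top: "filterlim (\<lambda>t. 2 * k / real n * (- (cb * (bp.P t)^2) + h t * exp (- l t))) at_top (at_left T)"
    using kpos n2 by (intro filterlim_tendsto_pos_mult_at_top[OF tendsto_const]) auto
  have ev: "eventually (\<lambda>t. 2 * k / real n * (- (cb * (bp.P t)^2) + h t * exp (- l t)) = bp.Q t) (at_left T)"
    using bp.ev_Ioo by eventually_elim (simp add: Q_eq rho_P_squared)
  have "filterlim bp.Q at_top (at_left T)"
    by (rule filterlim_cong[OF refl refl ev, THEN iffD1, OF top])
  then show False by (rule bp.Q_not_at_top)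
qed

lemma ln_v_at_top: "filterlim (\<lambda>t. - ln (v t)) at_top (at_left T)"
  using bp.ln_at_bot[OF bp.v_lim bp.v_pos] by (simp add: filterlim_uminus_at_bot)

text \<open>Dividing \<open>l\<close> by \<open>- ln v\<close> leaves a factor \<open>b\<close> with
  limit \<open>n - 2 J\<close>, because \<open>ln w / - ln v\<close> tends to \<open>1\<close>. A
  nonzero limit would send \<open>l\<close> to plus or minus infinity.\<close>

lemma n_eq_2J: "n = 2 * J"
proof -
  define b where "b t = - (real J - 2) + (real (n - J) - 2) * (ln (w t) / - ln (v t))" for t
  have b: "(b \<longlongrightarrow> real n - 2 * real J) (at_left T)"
    unfolding b_def[abs_def]
    by (rule tendsto_eq_intros bp.ln_ratio_lim refl)+ (use Jn in \<open>simp add: of_nat_diff\<close>)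
  have "eventually (\<lambda>t. - ln (v t) > 0) (at_left T)"
    using ln_v_at_top unfolding filterlim_at_top_dense by blast
  then have lb: "eventually (\<lambda>t. b t * - ln (v t) = l t) (at_left T)"
    by eventually_elim (simp add: b_def l_def field_simps)
  have "\<not> real n - 2 * real J > 0"
  proof
    assume "real n - 2 * real J > 0"
    then have "filterlim l at_top (at_left T)"
      by (intro filterlim_cong[OF refl refl lb, THEN iffD1]
          filterlim_tendsto_pos_mult_at_top[OF b _ ln_v_at_top])
    then show False using l_not_at_top by simp
  qed
  moreover have "\<not> real n - 2 * real J < 0"
  proof
    assume "real n - 2 * real J < 0"
    then have "filterlim l at_bot (at_left T)"
      by (intro filterlim_cong[OF refl refl lb, THEN iffD1]
          filterlim_tendsto_neg_mult_at_bot[OF b _ ln_v_at_top])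
    then show False using l_not_at_bot by simp
  qed
  ultimately show ?thesis by linarith
qed

lemma l_eq: "l t = (real J - 2) * ln (bp.P t)"
proof -
  have "n - J = J" using n_eq_2J by simp
  then show ?thesis using bp.v_pos[of t] bp.w_pos[of t]
    by (simp add: l_def bp.P_def ln_mult algebra_simps)
qed

text \<open>For \<open>n = 2 J\<close> the factor \<open>b\<close> above tends to \<open>0\<close>
  and decides nothing more, but now \<open>l = (J - 2) ln P\<close> exactly, and \<open>ln P\<close>
  is unbounded.\<close>

lemma J_eq: "J = 2"
proof -
  have P: "filterlim (\<lambda>t. - ln (bp.P t)) at_top (at_left T)"
    using bp.ln_at_bot[OF bp.P_lim bp.P_pos] by (simp add: filterlim_uminus_at_bot)
  have l: "l = (\<lambda>t. (2 - real J) * - ln (bp.P t))"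
    by (rule ext) (simp add: l_eq algebra_simps)
  have "\<not> 2 - real J > 0"
    using filterlim_tendsto_pos_mult_at_top[OF tendsto_const _ P, of "2 - real J"] l_not_at_top
    unfolding l by blast
  moreover have "\<not> 2 - real J < 0"
    using filterlim_tendsto_neg_mult_at_bot[OF tendsto_const _ P, of "2 - real J"] l_not_at_bot
    unfolding l by blast
  ultimately show ?thesis by linarith
qed

lemma n_eq: "n = 4" using n_eq_2J J_eq by linarith

lemma l_zero: "l t = 0"
proof -
  have "real J - 2 = 0" using J_eq by simp
  then show ?thesis unfolding l_eq by simp
qed

lemma real_n: "real n = 4" using n_eq by simp

lemma high_indices: "{J+1..n} = {3, n}" "n \<noteq> 3"
proof -
  show "n \<noteq> 3" using n_eq by simp
  show "{J+1..n} = {3, n}" unfolding J_eq n_eq by auto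
qed

section \<open>The critical density and the condition on the initial data\<close>

lemma rho_P_squared_lim: "((\<lambda>t. rho t * (bp.P t)^2) \<longlongrightarrow> rho0 / A) (at_left T)"
proof (rule Lim_transform_eventually[OF h_lim])
  show "eventually (\<lambda>t. h t = rho t * (bp.P t)^2) (at_left T)"
    using bp.ev_Ioo by eventually_elim (simp add: rho_P_squared l_zero)
qed

text \<open>As \<open>l\<close> vanishes and \<open>n = 4\<close>, \<open>Q\<close> tends to
  \<open>(k / 2) (rho0 / A)\<close>; this must equal \<open>2 (d / 2)^2\<close>.\<close>

lemma critical_density: "k * rho0 = d^2 * A"
proof -
  have "((\<lambda>t. h t * exp (- l t)) \<longlongrightarrow> rho0 / A) (at_left T)"
    using h_lim by (simp add: l_zero)
  from bp.Q_limit_eq[OF Q_lim[OF this]] show ?thesis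
    using A_pos by (simp add: real_n power2_eq_square field_simps)
qed

lemma a_n: "a n = 1" unfolding a_def d_def[symmetric] using d_pos by simp

lemma A_eq: "A = a 3"
  unfolding A_def high_indices(1) using high_indices(2) a_n by simp

lemma density_condition: "(lam0 1 - lam0 3) * (lam0 1 - lam0 4) = k * rho0"
proof -
  have "lam0 4 - lam0 1 = d" unfolding d_def using n_eq by simp
  moreover have "lam0 3 - lam0 1 = a 3 * d" using d_pos by (simp add: a_def)
  moreover have "(lam0 1 - lam0 3) * (lam0 1 - lam0 4) = (lam0 3 - lam0 1) * (lam0 4 - lam0 1)"
    by (simp add: algebra_simps)
  ultimately show ?thesis by (simp add: critical_density A_eq power2_eq_square)
qed

section \<open>Rates of blow-up\<close>

lemma P_rate:
  assumes a3: "a 3 \<le> 1"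
  obtains m where "m > 0" "((\<lambda>t. (T - t)^2 / bp.P t) \<longlongrightarrow> m) (at_left T)"
proof -
  have three: "3 \<in> {1..n}" "a 3 > 0" using n_eq J_eq a_pos[of 3] by auto
  have R: "k / 2 * (rho t * (bp.P t)^2) = d^2 / 2 * (a 3 * w t / uu lam 3 t)" if t: "t \<in> {0..<T}" for t
  proof -
    have "(\<Prod>i=J+1..n. uu lam i t / w t) = uu lam 3 t / w t"
      unfolding high_indices(1) using high_indices(2) bp.w_pos[of t] by (simp add: w_def)
    then have "rho t * (bp.P t)^2 = rho0 * (w t / uu lam 3 t)"
      using rho_P_squared[OF t] by (simp add: l_zero h_def)
    then have "k / 2 * (rho t * (bp.P t)^2) = (k * rho0) / 2 * (w t / uu lam 3 t)" by simp
    then show ?thesis unfolding critical_density A_eq by simp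
  qed
  have u3: "uu lam 3 t \<ge> a 3 * w t" "uu lam 3 t = a 3 * w t + (1 - a 3) * v t" if t: "t \<in> {0..<T}" for t
  proof -
    show "uu lam 3 t = a 3 * w t + (1 - a 3) * v t"
      using u_conv[OF three(1) t] by (simp add: algebra_simps)
    moreover have "(1 - a 3) * v t \<ge> 0" using a3 bp.v_pos[of t] by simp
    ultimately show "uu lam 3 t \<ge> a 3 * w t" by simp
  qed
  have Q: "bp.Q t = k / 2 * (rho t * (bp.P t)^2) - k / 2 * cb * (bp.P t)^2" for t
    by (simp add: Q_eq real_n field_simps)
  obtain c where c: "c > 0" "eventually (\<lambda>t. v t / w t \<le> c * (bp.P t)^2) (at_left T)"
    using bp.ratio_le_P_squared by blast
  \<comment> \<open>The assumption \<open>a 3 \<le> 1\<close> gives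
    \<open>u_3 \<ge> a 3 * w\<close>, so the density term of \<open>Q\<close> approaches its limit
    \<open>d^2 / 2\<close> from below.\<close>
  have "eventually (\<lambda>t. bp.Q t \<le> 2 * (d / 2)^2) (at_left T)"
    using bp.ev_Ioo
  proof eventually_elim
    case (elim t)
    then have t: "t \<in> {0..<T}" by auto
    have "a 3 * w t / uu lam 3 t \<le> 1" using u3(1)[OF t] u_pos[of 3 t] by simp
    then have "d^2 / 2 * (a 3 * w t / uu lam 3 t) \<le> d^2 / 2 * 1" by (intro mult_left_mono) auto
    moreover have "k / 2 * cb * (bp.P t)^2 \<ge> 0" using kpos cbpos by simp
    ultimately show ?case unfolding Q R[OF t] by (simp add: power2_eq_square)
  qed
  \<comment> \<open>The deficit \<open>1 - a 3 * w / u_3\<close> is at most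
    \<open>(1 - a 3) / a 3\<close> times \<open>v / w\<close>, hence of order \<open>P^2\<close>;
    the \<open>cb\<close> term supplies the rest of the coefficient.\<close>
  moreover have "eventually (\<lambda>t. 2 * (d / 2)^2 - (d^2 / 2 * ((1 - a 3) / a 3) * c + k / 2 * cb) * (bp.P t)^2 \<le> bp.Q t) (at_left T)"
    using bp.ev_Ioo c(2)
  proof eventually_elim
    case (elim t)
    then have t: "t \<in> {0..<T}" by auto
    have w: "w t > 0" and u: "uu lam 3 t > 0" and v: "v t > 0" by (rule bp.w_pos u_pos bp.v_pos)+
    have "1 - a 3 * w t / uu lam 3 t = (1 - a 3) * v t / uu lam 3 t"
      using u3(2)[OF t] u by (simp add: field_simps)
    also have "\<dots> \<le> (1 - a 3) * v t / (a 3 * w t)"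
      using u3(1)[OF t] a3 u v w three by (intro divide_left_mono mult_pos_pos mult_nonneg_nonneg) auto
    also have "\<dots> = (1 - a 3) / a 3 * (v t / w t)" by simp
    also have "\<dots> \<le> (1 - a 3) / a 3 * (c * (bp.P t)^2)"
      using elim a3 three by (intro mult_left_mono) auto
    finally have ineq: "d^2 / 2 * (1 - a 3 * w t / uu lam 3 t) \<le> d^2 / 2 * ((1 - a 3) / a 3 * (c * (bp.P t)^2))"
      by (intro mult_left_mono) auto
    define X where "X = (1 - a 3) / a 3"
    define f where "f = a 3 * w t / uu lam 3 t"
    have "2 * (d / 2)^2 = d^2 / 2" by (simp add: power2_eq_square)
    then show ?case
      using ineq unfolding Q R[OF t] X_def[symmetric] f_def[symmetric] by (simp add: algebra_simps)
  qed
  ultimately obtain m where m: "m > 0" "((\<lambda>t. sqrt (bp.P t) / (T - t)) \<longlongrightarrow> m) (at_left T)"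
    using bp.sqrt_P_asymptotics by blast
  show thesis
  proof (rule that[of "(1 / m)^2"])
    show "(1 / m)^2 > 0" using m by simp
    have "((\<lambda>t. (1 / (sqrt (bp.P t) / (T - t)))^2) \<longlongrightarrow> (1 / m)^2) (at_left T)"
      using m by (intro tendsto_power tendsto_divide tendsto_const) auto
    moreover have "(1 / (sqrt (bp.P t) / (T - t)))^2 = (T - t)^2 / bp.P t" for t
      using bp.P_pos[of t] by (simp add: power_divide)
    ultimately show "((\<lambda>t. (T - t)^2 / bp.P t) \<longlongrightarrow> (1 / m)^2) (at_left T)" by simp
  qed
qed

text \<open>\<open>lam 1 * P = v' w\<close> tends to \<open>- d / 2\<close>. For
  \<open>i = 3, 4\<close> the Wronskian adds \<open>d * a i * w / u_i\<close>, which tends to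
  \<open>d\<close>, so \<open>lam i * P\<close> tends to \<open>d / 2\<close>. Multiplying by
  \<open>(T - t)^2 / P\<close> gives \<open>C = m * (d / 2)\<close>, and
  \<open>critical_density\<close> expresses the limit for \<open>rho\<close> through the same
  \<open>C\<close>.\<close>

lemma blowup_rates:
  assumes a3: "a 3 \<le> 1"
  shows "\<exists>C>0. ((\<lambda>t. (T - t)^2 * lam 1 t) \<longlongrightarrow> - C) (at_left T) \<and>
      (\<forall>i\<in>{3, 4}. ((\<lambda>t. (T - t)^2 * lam i t) \<longlongrightarrow> C) (at_left T)) \<and>
      ((\<lambda>t. (T - t)^4 * rho t) \<longlongrightarrow> 4 / k * C^2) (at_left T)"
proof -
  obtain m where m: "m > 0" "((\<lambda>t. (T - t)^2 / bp.P t) \<longlongrightarrow> m) (at_left T)"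
    using P_rate[OF a3] by blast
  have cancel: "(T - t)^2 / bp.P t * (x * bp.P t) = (T - t)^2 * x" for x t
    using bp.P_pos[of t] by simp
  have P: "((\<lambda>t. lam 1 t * bp.P t) \<longlongrightarrow> - (d / 2)) (at_left T)"
    using bp.v'w_lim by (simp add: bp.P_def v'_def mult.assoc)
  have "((\<lambda>t. (T - t)^2 * lam i t) \<longlongrightarrow> m * (d / 2)) (at_left T)" if i: "i \<in> {3, 4}" for i
  proof -
    have i': "i \<in> {1..n}" "a i > 0" using i n_eq J_eq a_pos[of i] by auto
    have "((\<lambda>t. lam 1 t * bp.P t + d * a i / (uu lam i t / w t)) \<longlongrightarrow> - (d / 2) + d * a i / a i) (at_left T)"
      using i' by (intro tendsto_add P tendsto_divide tendsto_const u_ratio_lim) auto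
    moreover have "eventually (\<lambda>t. lam 1 t * bp.P t + d * a i / (uu lam i t / w t) = lam i t * bp.P t) (at_left T)"
      using bp.ev_Ioo
    proof eventually_elim
      case (elim t)
      then have e: "d * a i = (lam i t - lam 1 t) * uu lam i t * v t"
        using wronskian[OF i'(1), of t, folded v_def] d_pos by (simp add: a_def)
      show ?case
        unfolding e bp.P_def using u_pos[of i t] bp.w_pos[of t] by (simp add: field_simps)
    qed
    ultimately have "((\<lambda>t. lam i t * bp.P t) \<longlongrightarrow> - (d / 2) + d * a i / a i) (at_left T)"
      by (rule Lim_transform_eventually)
    then have "((\<lambda>t. lam i t * bp.P t) \<longlongrightarrow> d / 2) (at_left T)" using i' by simp
    from tendsto_mult[OF m(2) this] show ?thesis by (simp only: cancel)
  qed
  moreover have "((\<lambda>t. (T - t)^2 * lam 1 t) \<longlongrightarrow> - (m * (d / 2))) (at_left T)"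
    using tendsto_mult[OF m(2) P] by (simp only: cancel mult_minus_right)
  moreover have "((\<lambda>t. (T - t)^4 * rho t) \<longlongrightarrow> 4 / k * (m * (d / 2))^2) (at_left T)"
  proof -
    have "((\<lambda>t. ((T - t)^2 / bp.P t)^2 * (rho t * (bp.P t)^2)) \<longlongrightarrow> m^2 * (rho0 / A)) (at_left T)"
      by (intro tendsto_mult tendsto_power m(2) rho_P_squared_lim)
    moreover have "((T - t)^2 / bp.P t)^2 * (rho t * (bp.P t)^2) = (T - t)^4 * rho t" for t
      using bp.P_pos[of t] by (simp add: power_divide flip: power_mult)
    moreover have "m^2 * (rho0 / A) = 4 / k * (m * (d / 2))^2"
      using critical_density kpos A_pos by (simp add: field_simps power2_eq_square)
    ultimately show ?thesis by simp
  qed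
  moreover have "m * (d / 2) > 0" using m d_pos by simp
  ultimately show ?thesis by blast
qed

end

theorem theorem5p2:
  fixes n J :: nat and k cb rho0 tB p q :: real
    and lam0 :: "nat \<Rightarrow> real" and lam :: "nat \<Rightarrow> real \<Rightarrow> real" and rho :: "real \<Rightarrow> real"
  assumes n2: "n \<ge> 2" and kpos: "k > 0" and cbpos: "cb > 0" and rho0pos: "rho0 > 0"
    and J1: "1 \<le> J" and Jn: "J \<le> n"
    and eqJ: "\<forall>i\<in>{1..J}. lam0 i = lam0 1"
    and gapJ: "J < n \<longrightarrow> lam0 J < lam0 (J + 1)"
    and sortd: "\<forall>i. J + 1 \<le> i \<and> i < n \<longrightarrow> lam0 i \<le> lam0 (i + 1)"
    and tBpos: "0 < tB"
    and sol: "is_sol n k cb rho0 lam0 lam rho tB"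
    and maximal: "\<not> (\<exists>T > tB. \<exists>lam' rho'. is_sol n k cb rho0 lam0 lam' rho' T)"
    and limp: "((\<lambda>t. deriv (uu lam 1) t * uu lam n t) \<longlongrightarrow> - p) (at_left tB)"
    and limq: "((\<lambda>t. uu lam 1 t * deriv (uu lam n) t) \<longlongrightarrow> q) (at_left tB)"
    and pq: "p = q"
  shows "J = 2 \<and> n = 4 \<and> (lam0 1 - lam0 3) * (lam0 1 - lam0 4) = k * rho0 \<and>
    (\<exists>C > 0. ((\<lambda>t. (tB - t)^2 * lam 1 t) \<longlongrightarrow> - C) (at_left tB) \<and>
      (\<forall>i\<in>{3, 4}. ((\<lambda>t. (tB - t)^2 * lam i t) \<longlongrightarrow> C) (at_left tB)) \<and>
      ((\<lambda>t. (tB - t)^4 * rho t) \<longlongrightarrow> 4 / k * C^2) (at_left tB))"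
proof -
  have mono: "lam0 i \<le> lam0 j" if "J + 1 \<le> i" "i \<le> j" "j \<le> n" for i j
    using that(2,3)
  proof (induction j rule: dec_induct)
    case (step j)
    then show ?case using sortd that(1) by (metis Suc_eq_plus1 Suc_leD Suc_le_lessD le_trans order_trans)
  qed simp
  have high: "lam0 1 < lam0 i" if "i \<in> {J+1..n}" for i
  proof -
    have "lam0 1 = lam0 J" using eqJ J1 by (metis atLeastAtMost_iff order_refl)
    also have "\<dots> < lam0 (J + 1)" using gapJ that by auto
    also have "\<dots> \<le> lam0 i" using mono[of "J + 1" i] that by auto
    finally show ?thesis .
  qed
  have low: "lam0 i = lam0 1" if "i \<in> {1..J}" for i
    by (rule bspec[OF eqJ that])
  have min: "lam0 1 \<le> lam0 i" if "i \<in> {1..n}" for i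
    using low[of i] high[of i] that by (cases "i \<le> J") auto
  interpret flow_solution n k cb rho0 lam0 lam rho tB
    by unfold_locales (fact n2 kpos cbpos rho0pos tBpos sol min)+
  \<comment> \<open>A positive lower bound for \<open>u_1\<close> would allow continuation past
    \<open>tB\<close>, against maximality.\<close>
  have small: "\<exists>t\<in>{0..<tB}. uu lam 1 t < c" if "c > 0" for c
  proof (rule ccontr)
    assume "\<not> ?thesis"
    then have "uu lam 1 t \<ge> c" if "t \<in> {0..<tB}" for t using that by (auto simp: not_less)
    from u1_bounded_below_extends[OF \<open>c > 0\<close> this] show False using maximal by simp
  qed
  \<comment> \<open>For \<open>J = n\<close> all data are equal, and conservation of energy keeps
    \<open>u_1\<close> away from \<open>0\<close>.\<close>
  have "J \<noteq> n"
  proof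
    assume "J = n"
    then have "lam0 i = lam0 1" if "i \<in> {1..n}" for i using eqJ that by blast
    then obtain c where "c > 0" "\<forall>t\<in>{0..<tB}. uu lam 1 t \<ge> c"
      using u1_bounded_below_if_equal_data by blast
    then show False using small[of c] by force
  qed
  then have Jn': "J < n" using Jn by simp
  have ev: "eventually (\<lambda>t. t \<in> {0<..<tB}) (at_left tB)"
    by (rule eventually_at_left_Ioo[OF tBpos])
  have du: "deriv (uu lam i) t = lam i t * uu lam i t" if "i \<in> {1..n}" "t \<in> {0<..<tB}" for i t
    using u_deriv[of i t] that at_interior[of t] by (auto intro!: DERIV_imp_deriv)
  have lq: "((\<lambda>t. uu lam 1 t * (lam n t * uu lam n t)) \<longlongrightarrow> q) (at_left tB)"
    by (rule Lim_transform_eventually[OF limq])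
       (use ev in eventually_elim, use du n_in in auto)
  \<comment> \<open>The difference of the two expressions is the constant Wronskian, so its limit
    \<open>q + p\<close> equals \<open>lam0 n - lam0 1\<close>; with \<open>p = q\<close> this fixes
    \<open>q\<close>.\<close>
  have "((\<lambda>t. uu lam 1 t * deriv (uu lam n) t - deriv (uu lam 1) t * uu lam n t) \<longlongrightarrow> q - - p) (at_left tB)"
    by (rule tendsto_diff[OF limq limp])
  moreover have "eventually (\<lambda>t. uu lam 1 t * deriv (uu lam n) t - deriv (uu lam 1) t * uu lam n t
      = lam0 n - lam0 1) (at_left tB)"
    using ev
  proof eventually_elim
    case (elim t)
    then show ?case
      using wronskian[OF n_in, of t] du[OF one_in elim] du[OF n_in elim] by (simp add: algebra_simps)
  qed
  ultimately have "((\<lambda>t. lam0 n - lam0 1) \<longlongrightarrow> q - - p) (at_left tB)"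
    by (rule Lim_transform_eventually)
  then have "lam0 n - lam0 1 = q + p"
    by (simp add: tendsto_const_iff)
  then have q: "q = (lam0 n - lam0 1) / 2" using pq by simp
  interpret balanced_flow n k cb rho0 lam0 lam rho tB J
    by unfold_locales (fact J1 Jn' low high lq[unfolded q] small)+
  \<comment> \<open>Now \<open>J = 2\<close>, so index \<open>3\<close> begins the sorted block; the
    ordering yields the hypothesis of \<open>blowup_rates\<close>.\<close>
  have "lam0 3 \<le> lam0 n" by (rule mono) (use J_eq n_eq in auto)
  then have "a 3 \<le> 1" using d_pos unfolding a_def by (simp add: d_def)
  from blowup_rates[OF this] show ?thesis
    using J_eq n_eq density_condition by blast
qed

end
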